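(* For every $\varepsilon>0$, there exists a polycyclic, virtually metabelian group $G$, generated by $3$ elements, with $0<h(G)<\varepsilon$.
   Context: Let $G$ be a group generated by a finite symmetric set $S$, and let $B_n$ denote the $n$-ball of $G$ with respect to $S$, i.e. the set of elements that are products of at most $n$ elements of $S$. The limit $h(G,S)=\lim_{n\to\infty}\frac1n\log(\#(B_n))$ exists. The (algebraic) entropy of a finitely generated group $G$ is $h(G)=\inf_S h(G,S)$, where $S$ ranges over all finite symmetric generating subsets of $G$. A group is virtually metabelian if it has a metabelian subgroup of finite index. *)

theory Defs
  imports Complex_Main "HOL-Algebra.Algebra"
begin

definition metabelian :: "('a, 'b) monoid_scheme \<Rightarrow> bool" where
  "metabelian G \<longleftrightarrow> comm_group (G\<lparr>carrier := derived G (carrier G)\<rparr>)"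

definition virtually_metabelian :: "('a, 'b) monoid_scheme \<Rightarrow> bool" where
  "virtually_metabelian G \<longleftrightarrow>
     (\<exists>H. subgroup H G \<and> finite (rcosets\<^bsub>G\<^esub> H) \<and> metabelian (G\<lparr>carrier := H\<rparr>))"

definition polycyclic :: "('a, 'b) monoid_scheme \<Rightarrow> bool" where
  "polycyclic G \<longleftrightarrow>
     (\<exists>(n :: nat) H. H 0 = carrier G \<and> H n = {\<one>\<^bsub>G\<^esub>} \<and>
        (\<forall>i\<le>n. subgroup (H i) G) \<and>
        (\<forall>i<n. H (Suc i) \<lhd> G\<lparr>carrier := H i\<rparr> \<and>
               cyclic_group (G\<lparr>carrier := H i\<rparr> Mod H (Suc i))))"

definition symmetric_generating_set :: "('a, 'b) monoid_scheme \<Rightarrow> 'a set \<Rightarrow> bool" where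
  "symmetric_generating_set G S \<longleftrightarrow>
     S \<subseteq> carrier G \<and> (\<forall>s\<in>S. inv\<^bsub>G\<^esub> s \<in> S) \<and> generate G S = carrier G"

definition word_ball :: "('a, 'b) monoid_scheme \<Rightarrow> 'a set \<Rightarrow> nat \<Rightarrow> 'a set" where
  "word_ball G S n =
     {foldr (\<otimes>\<^bsub>G\<^esub>) w \<one>\<^bsub>G\<^esub> | w. set w \<subseteq> S \<and> length w \<le> n}"

definition growth_entropy :: "('a, 'b) monoid_scheme \<Rightarrow> 'a set \<Rightarrow> real" where
  "growth_entropy G S = lim (\<lambda>n. 1 / real n * ln (real (card (word_ball G S n))))"

(* Meaningful for finitely generated G only: otherwise this is the infimum of the empty set. *)
definition algebraic_entropy :: "('a, 'b) monoid_scheme \<Rightarrow> real" where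
  "algebraic_entropy G = (INF S\<in>{S. finite S \<and> symmetric_generating_set G S}. growth_entropy G S)"

end

theory Submission
  imports Defs "HOL-Library.Product_Plus"
begin

text \<open>
  Take a quotient \<open>H\<close> of \<open>\<int>/2 * (\<int>/2)\<^sup>2\<close>, with generators a and b, c, d, and let \<open>\<Phi>(H)\<close> be the subgroup
  of the wreath product of \<open>H\<close> by \<open>\<int>/2\<close> generated by Grigorchuk's formulas \<open>a = \<sigma>\<close>, \<open>b = (a, c)\<close>,
  \<open>c = (a, d)\<close>, \<open>d = (1, b)\<close>; it is again such a quotient. For suitable weights of the letters, the total
  weight of the two coordinates of an element of \<open>\<Phi>(H)\<close> is at most \<open>5/6\<close> of its weight, up to a constant, so
  each application of \<open>\<Phi>\<close> multiplies the bound on the exponential growth rate by a factor smaller than 1.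
  On the other hand, the stabiliser of a coordinate has index two and projects onto \<open>H\<close>, hence uniform
  exponential growth passes from \<open>H\<close> to \<open>\<Phi>(H)\<close>; so do polycyclicity and virtual metabelianity.

  The recursion starts with a group of affine maps of \<open>\<int>\<^sup>2\<close> whose linear part is virtually generated by
  a hyperbolic matrix. On an eigenline, a subgroup of index two acts by affine maps of the real line with
  ratios \<open>\<plusminus>\<lambda>\<^sup>k\<close>, \<open>\<lambda> \<ge> 2\<close>; every finite generating set has short words that are two contractions of the same
  ratio with different fixed points, and these generate a free semigroup.
\<close>

section \<open>Growth of balls\<close>

text \<open>The two bounds on the entropy are of different kinds. It is an infimum over all finite
  symmetric generating sets, so smallness has to be seen on one set only, the marking, whereas
  positivity needs a growth rate common to all sets. That rate may get worse at every step (it drops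
  to a cube root) as long as it stays above 1. The contraction rests on alternating words: each b,
  c, d, except perhaps the first, is preceded by an a, which adds nothing to the coordinates. An
  element of weight n is thus given by a swap bit and two elements of weights at most i and m - i,
  where m is about 5n/6. If the balls of \<open>H\<close> grow like exp(mu n), each i contributes
  exp(mu m); the m + 1 values of i cost a linear factor, absorbed by raising the exponent by one
  twentieth. Hence the factor 21/20 * 5/6 = 7/8 per step. For a given bound finitely many steps
  suffice, so the exponential growth of the initial group is never lost.\<close>

text \<open>Fekete's lemma: the limit is the infimum \<open>L\<close>. With \<open>u m / m\<close>
  close to \<open>L\<close>, the q blocks of n = q m + r cost at most (L + e/2) n, and the rest is
  bounded independently of n.\<close>

lemma subadditive_convergent:
  fixes u :: "nat \<Rightarrow> real"
  assumes sub: "\<And>m n. u (m + n) \<le> u m + u n" and nonneg: "\<And>n. 0 \<le> u n"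
  shows "convergent (\<lambda>n. u n / real n)"
proof -
  define L where "L = (INF n\<in>{1..}. u n / real n)"
  have bdd: "bdd_below ((\<lambda>n. u n / real n) ` {1..})"
    by (rule bdd_belowI2[where m = 0]) (simp add: nonneg)
  have lower: "L \<le> u n / real n" if "n \<ge> 1" for n
    unfolding L_def using bdd that by (intro cINF_lower) auto
  have mult: "u (q * m) \<le> real q * u m + u 0" for q m
  proof (induction q)
    case (Suc q)
    have "u (Suc q * m) \<le> u m + u (q * m)" using sub[of m "q * m"] by simp
    then show ?case using Suc by (simp add: algebra_simps)
  qed simp
  have "(\<lambda>n. u n / real n) \<longlonglongrightarrow> L"
  proof (rule LIMSEQ_I)
    fix e :: real assume e: "e > 0"
    have "\<exists>m\<in>{1..}. u m / real m < L + e / 2"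
      using cINF_less_iff[OF _ bdd, of "L + e / 2"] e by (auto simp: L_def)
    then obtain m where m: "m \<ge> 1" "u m / real m < L + e / 2" by auto
    \<comment> \<open>\<open>R\<close> bounds all that does not grow with n: the remainder term
      \<open>u (n mod m)\<close>, and the \<open>u 0\<close> that \<open>mult\<close> leaves over at
      q = 0.\<close>
    define R where "R = u 0 + (\<Sum>r<m. u r)"
    have R0: "R \<ge> 0" unfolding R_def using nonneg by (simp add: sum_nonneg)
    obtain N where N: "real N > 2 * R / e" using reals_Archimedean2 by blast
    have "norm (u n / real n - L) < e" if n: "n \<ge> Suc N" for n
    proof -
      have npos: "real n > 0" using n by simp
      have um: "u m \<le> (L + e / 2) * real m" using m by (simp add: divide_simps mult.commute)
      have L0: "L + e / 2 > 0"
        using m nonneg[of m] by (smt (verit) divide_nonneg_nonneg of_nat_0_le_iff)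
      have ur: "u (n mod m) \<le> (\<Sum>r<m. u r)"
        using m nonneg by (intro member_le_sum) auto
      have "u n = u (n div m * m + n mod m)" by simp
      also have "\<dots> \<le> u (n div m * m) + u (n mod m)" by (rule sub)
      also have "\<dots> \<le> real (n div m) * u m + R" using mult[of "n div m" m] ur by (simp add: R_def)
      also have "\<dots> \<le> real (n div m) * ((L + e / 2) * real m) + R"
        using um by (simp add: mult_left_mono)
      also have "\<dots> = (L + e / 2) * real (n div m * m) + R" by simp
      also have "\<dots> \<le> (L + e / 2) * real n + R"
        using L0 by (intro add_right_mono mult_left_mono) (simp_all del: of_nat_mult)
      finally have 1: "u n \<le> (L + e / 2) * real n + R" .
      have "2 * R / e < real n" using N n by linarith
      then have "R < e / 2 * real n" using e by (simp add: field_simps)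
      then have "u n < (L + e) * real n" using 1 by (simp add: algebra_simps)
      then have "u n / real n < L + e" using npos by (simp add: divide_simps mult.commute)
      then show ?thesis using lower[of n] n by (simp add: abs_less_iff)
    qed
    then show "\<exists>no. \<forall>n\<ge>no. norm (u n / real n - L) < e" by blast
  qed
  then show ?thesis by (auto simp: convergent_def)
qed

context group begin

lemma foldr_mult_closed:
  "set w \<subseteq> carrier G \<Longrightarrow> foldr (\<otimes>) w \<one> \<in> carrier G"
  by (induction w) auto

lemma foldr_mult_append:
  "set v \<subseteq> carrier G \<Longrightarrow> set w \<subseteq> carrier G \<Longrightarrow>
    foldr (\<otimes>) (v @ w) \<one> = foldr (\<otimes>) v \<one> \<otimes> foldr (\<otimes>) w \<one>"
proof (induction v)
  case Nil
  then show ?case using foldr_mult_closed by simp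
next
  case (Cons x v)
  then show ?case using foldr_mult_closed by (simp add: m_assoc)
qed

lemma word_ballI: "set w \<subseteq> S \<Longrightarrow> length w \<le> n \<Longrightarrow> foldr (\<otimes>) w \<one> \<in> word_ball G S n"
  unfolding word_ball_def by blast

lemma word_ball_mono: "m \<le> n \<Longrightarrow> word_ball G S m \<subseteq> word_ball G S n"
  unfolding word_ball_def by fastforce

lemma one_in_word_ball: "\<one> \<in> word_ball G S n"
  using word_ballI[of "[]"] by simp

lemma generator_in_word_ball: "S \<subseteq> carrier G \<Longrightarrow> s \<in> S \<Longrightarrow> s \<in> word_ball G S 1"
  using word_ballI[of "[s]" S 1] by auto

lemma finite_word_ball: "finite S \<Longrightarrow> finite (word_ball G S n)"
proof -
  assume "finite S"
  then have "finite {w. set w \<subseteq> S \<and> length w \<le> n}" by (rule finite_lists_length_le)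
  moreover have "word_ball G S n = (\<lambda>w. foldr (\<otimes>) w \<one>) ` {w. set w \<subseteq> S \<and> length w \<le> n}"
    unfolding word_ball_def by blast
  ultimately show ?thesis by simp
qed

lemma word_ball_mult:
  assumes "S \<subseteq> carrier G" "x \<in> word_ball G S m" "y \<in> word_ball G S n"
  shows "x \<otimes> y \<in> word_ball G S (m + n)"
proof -
  obtain v w where v: "set v \<subseteq> S" "length v \<le> m" "x = foldr (\<otimes>) v \<one>"
    and w: "set w \<subseteq> S" "length w \<le> n" "y = foldr (\<otimes>) w \<one>"
    using assms unfolding word_ball_def by blast
  have "x \<otimes> y = foldr (\<otimes>) (v @ w) \<one>"
    using foldr_mult_append[of v w] v w assms(1) by auto
  then show ?thesis using word_ballI[of "v @ w" S "m + n"] v w by simp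
qed

lemma word_ball_inv:
  assumes S: "S \<subseteq> carrier G" "\<And>s. s \<in> S \<Longrightarrow> inv s \<in> S" and x: "x \<in> word_ball G S n"
  shows "inv x \<in> word_ball G S n"
proof -
  have "inv (foldr (\<otimes>) w \<one>) \<in> word_ball G S (length w)" if "set w \<subseteq> S" for w
    using that
  proof (induction w)
    case (Cons a w)
    have a: "a \<in> carrier G" and w: "foldr (\<otimes>) w \<one> \<in> carrier G"
      using Cons.prems S(1) foldr_mult_closed[of w] by auto
    have "inv (foldr (\<otimes>) w \<one>) \<otimes> inv a \<in> word_ball G S (length w + 1)"
      using Cons S(2) by (intro word_ball_mult[OF S(1)] generator_in_word_ball[OF S(1)]) auto
    then show ?case using a w by (simp add: inv_mult_group)
  qed (simp add: one_in_word_ball)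
  then show ?thesis using x word_ball_mono unfolding word_ball_def by blast
qed

lemma word_ball_word_ball:
  assumes S: "S \<subseteq> carrier G" and T: "T \<subseteq> word_ball G S k"
  shows "word_ball G T n \<subseteq> word_ball G S (k * n)"
proof -
  have "foldr (\<otimes>) w \<one> \<in> word_ball G S (k * length w)" if "set w \<subseteq> T" for w
    using that
  proof (induction w)
    case (Cons a w)
    have "a \<otimes> foldr (\<otimes>) w \<one> \<in> word_ball G S (k + k * length w)"
      using Cons T by (intro word_ball_mult[OF S]) auto
    then show ?case by simp
  qed (simp add: one_in_word_ball)
  then have "foldr (\<otimes>) w \<one> \<in> word_ball G S (k * n)" if "set w \<subseteq> T" "length w \<le> n" for w
    using that word_ball_mono[of "k * length w" "k * n" S] by auto
  then show ?thesis unfolding word_ball_def[of G T] by auto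
qed

lemma card_word_ball_submult:
  assumes S: "S \<subseteq> carrier G" "finite S"
  shows "card (word_ball G S (m + n)) \<le> card (word_ball G S m) * card (word_ball G S n)"
proof -
  have "word_ball G S (m + n) \<subseteq> (\<lambda>(x, y). x \<otimes> y) ` (word_ball G S m \<times> word_ball G S n)"
  proof
    fix x assume "x \<in> word_ball G S (m + n)"
    then obtain w where w: "set w \<subseteq> S" "length w \<le> m + n" "x = foldr (\<otimes>) w \<one>"
      unfolding word_ball_def by blast
    have sub: "set (take m w) \<subseteq> S" "set (drop m w) \<subseteq> S"
      using w set_take_subset set_drop_subset by fast+
    have "x = foldr (\<otimes>) (take m w) \<one> \<otimes> foldr (\<otimes>) (drop m w) \<one>"
      using foldr_mult_append[of "take m w" "drop m w"] sub S w by auto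
    moreover have "foldr (\<otimes>) (take m w) \<one> \<in> word_ball G S m" "foldr (\<otimes>) (drop m w) \<one> \<in> word_ball G S n"
      using sub w by (auto intro!: word_ballI)
    ultimately show "x \<in> (\<lambda>(x, y). x \<otimes> y) ` (word_ball G S m \<times> word_ball G S n)" by blast
  qed
  then have "card (word_ball G S (m + n)) \<le> card (word_ball G S m \<times> word_ball G S n)"
    using finite_word_ball[OF S(2)] by (meson card_image_le card_mono finite_SigmaI finite_imageI order_trans)
  then show ?thesis by (simp add: card_cartesian_product)
qed

lemma card_word_ball_pos: "finite S \<Longrightarrow> card (word_ball G S n) \<ge> 1"
  using finite_word_ball one_in_word_ball by (metis One_nat_def Suc_leI card_gt_0_iff empty_iff)

text \<open>\<open>lim\<close> has an unspecified value on divergent sequences, so this is what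
  gives \<open>growth_entropy\<close> its meaning. The logarithm turns submultiplicativity of ball
  sizes into subadditivity.\<close>

lemma growth_entropy_LIMSEQ:
  assumes S: "S \<subseteq> carrier G" "finite S"
  shows "(\<lambda>n. 1 / real n * ln (real (card (word_ball G S n)))) \<longlonglongrightarrow> growth_entropy G S"
proof -
  have pos: "real (card (word_ball G S n)) \<ge> 1" for n
    using card_word_ball_pos[OF S(2), of n] by simp
  have "convergent (\<lambda>n. ln (real (card (word_ball G S n))) / real n)"
  proof (rule subadditive_convergent)
    fix m n
    have "real (card (word_ball G S (m + n))) \<le> real (card (word_ball G S m)) * real (card (word_ball G S n))"
      using card_word_ball_submult[OF S, of m n] by (simp flip: of_nat_mult)
    then have "ln (real (card (word_ball G S (m + n)))) \<le> ln (real (card (word_ball G S m)) * real (card (word_ball G S n)))"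
      using pos[of "m + n"] by (subst ln_le_cancel_iff) linarith+
    then show "ln (real (card (word_ball G S (m + n)))) \<le> ln (real (card (word_ball G S m))) + ln (real (card (word_ball G S n)))"
      using pos[of m] pos[of n] by (simp add: ln_mult split: if_splits)
  qed (use pos in simp)
  then show ?thesis unfolding growth_entropy_def by (simp add: convergent_LIMSEQ_iff)
qed

lemma growth_entropy_ge:
  assumes S: "S \<subseteq> carrier G" "finite S" and K: "K > 0" and c: "c > 0"
    and bound: "\<And>n. K * c ^ n \<le> real (card (word_ball G S n))"
  shows "ln c \<le> growth_entropy G S"
proof (rule LIMSEQ_le[OF _ growth_entropy_LIMSEQ[OF S]])
  have "(\<lambda>n. ln K * (1 / real n) + ln c) \<longlonglongrightarrow> ln K * 0 + ln c"
    by (intro tendsto_intros lim_1_over_n)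
  then show "(\<lambda>n. ln K * (1 / real n) + ln c) \<longlonglongrightarrow> ln c" by simp
  have "ln K * (1 / real n) + ln c \<le> 1 / real n * ln (real (card (word_ball G S n)))" if "n \<ge> 1" for n
  proof -
    have "ln (K * c ^ n) \<le> ln (real (card (word_ball G S n)))"
      using bound[of n] K c by (metis ln_mono mult_pos_pos zero_less_power)
    then have "ln K + real n * ln c \<le> ln (real (card (word_ball G S n)))"
      using K c by (simp add: ln_mult ln_realpow)
    then have "(ln K + real n * ln c) / real n \<le> ln (real (card (word_ball G S n))) / real n"
      by (rule divide_right_mono) simp
    then show ?thesis using that by (simp add: add_divide_distrib)
  qed
  then show "\<exists>N. \<forall>n\<ge>N. ln K * (1 / real n) + ln c \<le> 1 / real n * ln (real (card (word_ball G S n)))"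
    by blast
qed

lemma growth_entropy_le:
  assumes S: "S \<subseteq> carrier G" "finite S" and K: "K > 0"
    and bound: "\<And>n. real (card (word_ball G S n)) \<le> K * exp (\<mu> * real n)"
  shows "growth_entropy G S \<le> \<mu>"
proof (rule LIMSEQ_le[OF growth_entropy_LIMSEQ[OF S]])
  have "(\<lambda>n. ln K * (1 / real n) + \<mu>) \<longlonglongrightarrow> ln K * 0 + \<mu>"
    by (intro tendsto_intros lim_1_over_n)
  then show "(\<lambda>n. ln K * (1 / real n) + \<mu>) \<longlonglongrightarrow> \<mu>" by simp
  have "1 / real n * ln (real (card (word_ball G S n))) \<le> ln K * (1 / real n) + \<mu>" if "n \<ge> 1" for n
  proof -
    have "ln (real (card (word_ball G S n))) \<le> ln (K * exp (\<mu> * real n))"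
      using bound[of n] card_word_ball_pos[OF S(2), of n] by (intro ln_mono) simp_all
    then have "ln (real (card (word_ball G S n))) \<le> ln K + \<mu> * real n"
      using K by (simp add: ln_mult)
    then have "ln (real (card (word_ball G S n))) / real n \<le> (ln K + \<mu> * real n) / real n"
      by (rule divide_right_mono) simp
    then show ?thesis using that by (simp add: add_divide_distrib)
  qed
  then show "\<exists>N. \<forall>n\<ge>N. 1 / real n * ln (real (card (word_ball G S n))) \<le> ln K * (1 / real n) + \<mu>"
    by blast
qed

end

section \<open>Uniform exponential growth and subgroups of index two\<close>

text \<open>The rate \<open>c\<close> is common to all generating sets, while \<open>K\<close> may
  depend on the set: \<open>K\<close> disappears in the limit, so \<open>ln c\<close> bounds the
  infimum from below.\<close>

definition uniform_growth :: "('a, 'b) monoid_scheme \<Rightarrow> real \<Rightarrow> bool" where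
  "uniform_growth G c \<longleftrightarrow>
     (\<forall>S. finite S \<longrightarrow> symmetric_generating_set G S \<longrightarrow>
        (\<exists>K>0. \<forall>n. K * c ^ n \<le> real (card (word_ball G S n))))"

text \<open>Three is the length of the words used both as Schreier generators and as the ping-pong
  pair. Dividing \<open>K\<close> by \<open>d ^ 2\<close> pays for the remainder of n modulo
  3.\<close>

lemma (in group) growth_from_every_third_ball:
  fixes d K :: real
  assumes S: "finite S" and d: "d \<ge> 1" and K: "K > 0"
    and bound: "\<And>n. K * (d ^ 3) ^ n \<le> real (card (word_ball G S (3 * n)))"
  shows "\<exists>K>0. \<forall>n. K * d ^ n \<le> real (card (word_ball G S n))"
proof (intro exI[of _ "K / d ^ 2"] conjI allI)
  show "K / d ^ 2 > 0" using d K by simp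
  fix n
  have "d ^ n \<le> d ^ (3 * (n div 3) + 2)" using d by (intro power_increasing) linarith+
  also have "\<dots> = (d ^ 3) ^ (n div 3) * d ^ 2" by (simp only: power_add power_mult)
  finally have "K / d ^ 2 * d ^ n \<le> K / d ^ 2 * ((d ^ 3) ^ (n div 3) * d ^ 2)"
    using d K by (intro mult_left_mono) auto
  also have "\<dots> = K * (d ^ 3) ^ (n div 3)" using d by simp
  also have "\<dots> \<le> real (card (word_ball G S (3 * (n div 3))))" by (rule bound)
  also have "\<dots> \<le> real (card (word_ball G S n))"
    using word_ball_mono[of "3 * (n div 3)" n S] finite_word_ball[OF S] by (simp add: card_mono)
  finally show "K / d ^ 2 * d ^ n \<le> real (card (word_ball G S n))" .
qed

text \<open>Schreier rewriting: an element outside of the subgroup \<open>N\<close> of index two is absorbed by a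
  fixed \<open>t \<in> S - N\<close>, so words of length at most three in \<open>S\<close> generate \<open>N\<close>.\<close>

lemma (in group) index_two_generators:
  assumes S: "symmetric_generating_set G S" and N: "subgroup N G"
    and index: "\<And>x y. x \<in> carrier G - N \<Longrightarrow> y \<in> carrier G - N \<Longrightarrow> x \<otimes> y \<in> N"
  shows "generate G (word_ball G S 3 \<inter> N) = N"
proof -
  interpret N: subgroup N G by fact
  define T where "T = word_ball G S 3 \<inter> N"
  have Sc: "S \<subseteq> carrier G" and gen: "generate G S = carrier G" and sym: "\<And>s. s \<in> S \<Longrightarrow> inv s \<in> S"
    using S unfolding symmetric_generating_set_def by auto
  have Tc: "T \<subseteq> carrier G" unfolding T_def using N.subset by blast
  have T1: "s \<in> T" if "s \<in> S" "s \<in> N" for s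
    using that generator_in_word_ball[OF Sc] word_ball_mono[of 1 3 S] unfolding T_def by auto
  have T2: "x \<otimes> y \<in> T" if "x \<in> S" "y \<in> S" "x \<otimes> y \<in> N" for x y
    using that word_ball_mult[OF Sc generator_in_word_ball[OF Sc] generator_in_word_ball[OF Sc], of x y]
      word_ball_mono[of "1 + 1" 3 S] unfolding T_def by auto
  have T3: "x \<otimes> (y \<otimes> z) \<in> T" if "x \<in> S" "y \<in> S" "z \<in> S" "x \<otimes> (y \<otimes> z) \<in> N" for x y z
    using that word_ball_mult[OF Sc generator_in_word_ball[OF Sc]
        word_ball_mult[OF Sc generator_in_word_ball[OF Sc] generator_in_word_ball[OF Sc]], of x y z]
    unfolding T_def by (auto simp: numeral_3_eq_3)
  have outer: "x \<otimes> y \<notin> N" "y \<otimes> x \<notin> N" if "x \<in> N" "y \<in> carrier G" "y \<notin> N" for x y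
    using that by (metis N.mem_carrier N.m_closed N.m_inv_closed inv_solve_left inv_solve_right m_closed)+
  have "N \<subseteq> generate G T"
  proof (cases "S \<subseteq> N")
    case True
    then have "S \<subseteq> T" using T1 by blast
    then show ?thesis using mono_generate[of S T] gen N.subset by blast
  next
    case False
    then obtain t where t: "t \<in> S" "t \<notin> N" by blast
    then have tc: "t \<in> carrier G" "inv t \<in> S" "inv t \<in> carrier G" "inv t \<notin> N"
      using Sc sym N.m_inv_closed by (auto, metis N.m_inv_closed inv_inv subsetD)
    \<comment> \<open>Each suffix of the word evaluates into the subgroup generated by
      \<open>T\<close>, or to t times such an element. Prepending s introduces one of s, t^-1 s t,
      t^-1 s, s t, which has length at most three and lies in \<open>N\<close> in the case where it
      occurs.\<close>
    have "foldr (\<otimes>) w \<one> \<in> generate G T \<or> (\<exists>h\<in>generate G T. foldr (\<otimes>) w \<one> = t \<otimes> h)"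
      if "set w \<subseteq> S" for w
      using that
    proof (induction w)
      case Nil
      then show ?case by (simp add: generate.one)
    next
      case (Cons s w)
      define g where "g = foldr (\<otimes>) w \<one>"
      have s: "s \<in> S" "s \<in> carrier G" using Cons.prems Sc by auto
      have IH: "g \<in> generate G T \<or> (\<exists>h\<in>generate G T. g = t \<otimes> h)"
        using Cons unfolding g_def by simp
      have gT: "h \<in> carrier G" if "h \<in> generate G T" for h
        using that generate_in_carrier[OF Tc] by blast
      have "s \<otimes> g \<in> generate G T \<or> (\<exists>h\<in>generate G T. s \<otimes> g = t \<otimes> h)"
      proof (cases "s \<in> N")
        case sN: True
        from IH show ?thesis
        proof
          assume "g \<in> generate G T"
          then show ?thesis using T1 s sN by (blast intro: generate.eng generate.incl)
        next
          assume "\<exists>h\<in>generate G T. g = t \<otimes> h"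
          then obtain h where h: "h \<in> generate G T" "g = t \<otimes> h" by blast
          have "inv t \<otimes> (s \<otimes> t) \<in> N" using outer[of s t] t tc s sN by (intro index) auto
          then have "inv t \<otimes> (s \<otimes> t) \<in> T" using T3 t tc s by blast
          then have "(inv t \<otimes> (s \<otimes> t)) \<otimes> h \<in> generate G T"
            using h by (blast intro: generate.eng generate.incl)
          moreover have "s \<otimes> g = t \<otimes> ((inv t \<otimes> (s \<otimes> t)) \<otimes> h)"
            using h gT tc s by (simp add: m_assoc flip: m_assoc[of t "inv t"])
          ultimately show ?thesis by blast
        qed
      next
        case sN: False
        from IH show ?thesis
        proof
          assume g: "g \<in> generate G T"
          have "inv t \<otimes> s \<in> T" using T2 index tc s sN by blast
          then have "(inv t \<otimes> s) \<otimes> g \<in> generate G T"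
            using g by (blast intro: generate.eng generate.incl)
          moreover have "s \<otimes> g = t \<otimes> ((inv t \<otimes> s) \<otimes> g)"
            using g gT tc s by (simp add: m_assoc flip: m_assoc[of t "inv t"])
          ultimately show ?thesis by blast
        next
          assume "\<exists>h\<in>generate G T. g = t \<otimes> h"
          then obtain h where h: "h \<in> generate G T" "g = t \<otimes> h" by blast
          have "s \<otimes> t \<in> T" using T2 index t tc s sN by blast
          then have "(s \<otimes> t) \<otimes> h \<in> generate G T"
            using h by (blast intro: generate.eng generate.incl)
          then show ?thesis using h gT tc s by (simp add: m_assoc)
        qed
      qed
      then show ?case unfolding g_def by simp
    qed
    note words = this
    have gen_word: "\<exists>w. set w \<subseteq> S \<and> x = foldr (\<otimes>) w \<one>" if "x \<in> generate G S" for x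
      using that
    proof induction
      case one
      show ?case by (intro exI[of _ "[]"]) simp
    next
      case (incl s)
      then show ?case using Sc by (intro exI[of _ "[s]"]) auto
    next
      case (inv s)
      then show ?case using Sc sym by (intro exI[of _ "[inv s]"]) auto
    next
      case (eng x y)
      then obtain v w where "set v \<subseteq> S" "x = foldr (\<otimes>) v \<one>" "set w \<subseteq> S" "y = foldr (\<otimes>) w \<one>"
        by blast
      then show ?case using foldr_mult_append[of v w] Sc by (intro exI[of _ "v @ w"]) auto
    qed
    show ?thesis
    proof
      fix x assume x: "x \<in> N"
      then obtain w where "set w \<subseteq> S" "x = foldr (\<otimes>) w \<one>"
        using gen_word gen N.subset by blast
      then consider "x \<in> generate G T" | h where "h \<in> generate G T" "x = t \<otimes> h"
        using words by blast
      then show "x \<in> generate G T"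
      proof cases
        case 2
        have "h \<in> N" using 2 generate_subgroup_incl[of T N] N unfolding T_def by blast
        then show ?thesis using outer[of h t] t tc 2 x by blast
      qed
    qed
  qed
  moreover have "generate G T \<subseteq> N" using generate_subgroup_incl[of T N] N unfolding T_def by blast
  ultimately show ?thesis unfolding T_def by blast
qed

lemma word_ball_consistent: "word_ball (G\<lparr>carrier := N\<rparr>) S n = word_ball G S n"
  unfolding word_ball_def by simp

lemma hom_word_ball:
  assumes G: "group G" and H: "group H" and f: "f \<in> hom G H" and S: "S \<subseteq> carrier G"
  shows "word_ball H (f ` S) n = f ` word_ball G S n"
proof -
  interpret G: group G by fact
  interpret f: group_hom G H f using assms by (simp add: group_hom_def group_hom_axioms_def)
  have map: "foldr (\<otimes>\<^bsub>H\<^esub>) (map f w) \<one>\<^bsub>H\<^esub> = f (foldr (\<otimes>\<^bsub>G\<^esub>) w \<one>\<^bsub>G\<^esub>)"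
    if "set w \<subseteq> S" for w
    using that
  proof (induction w)
    case (Cons a w)
    moreover have "foldr (\<otimes>\<^bsub>G\<^esub>) w \<one>\<^bsub>G\<^esub> \<in> carrier G"
      using Cons.prems S by (intro G.foldr_mult_closed) auto
    moreover have "a \<in> carrier G" using Cons.prems S by auto
    ultimately show ?case by simp
  qed simp
  show ?thesis
  proof
    show "word_ball H (f ` S) n \<subseteq> f ` word_ball G S n"
    proof
      fix y assume "y \<in> word_ball H (f ` S) n"
      then obtain v where v: "set v \<subseteq> f ` S" "length v \<le> n" "y = foldr (\<otimes>\<^bsub>H\<^esub>) v \<one>\<^bsub>H\<^esub>"
        unfolding word_ball_def by blast
      then have "v \<in> map f ` lists S" by (metis in_listsI in_mono lists_image)
      then obtain w where "v = map f w" "set w \<subseteq> S" by (auto simp: lists_eq_set)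
      then show "y \<in> f ` word_ball G S n" using v map unfolding word_ball_def by auto
    qed
    show "f ` word_ball G S n \<subseteq> word_ball H (f ` S) n"
    proof
      fix y assume "y \<in> f ` word_ball G S n"
      then obtain w where w: "set w \<subseteq> S" "length w \<le> n" "y = f (foldr (\<otimes>\<^bsub>G\<^esub>) w \<one>\<^bsub>G\<^esub>)"
        unfolding word_ball_def by blast
      then show "y \<in> word_ball H (f ` S) n"
        using map[of w] unfolding word_ball_def by (force intro!: exI[of _ "map f w"])
    qed
  qed
qed

text \<open>The elements of \<open>N\<close> of length at most three generate \<open>N\<close>, and
  their images form a finite symmetric generating set of \<open>H\<close>. An n-ball of
  \<open>H\<close> is thus an image of elements of the 3n-ball of \<open>G\<close>; the tripled
  radius is why the rate drops to a cube root.\<close>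

lemma uniform_growth_index_two:
  fixes d :: real
  assumes G: "group G" and N: "subgroup N G"
    and index: "\<And>x y. x \<in> carrier G - N \<Longrightarrow> y \<in> carrier G - N \<Longrightarrow> x \<otimes>\<^bsub>G\<^esub> y \<in> N"
    and H: "group H" and f: "f \<in> hom (G\<lparr>carrier := N\<rparr>) H" "f ` N = carrier H"
    and d: "d \<ge> 1" and ug: "uniform_growth H (d ^ 3)"
  shows "uniform_growth G d"
  unfolding uniform_growth_def
proof (intro allI impI)
  fix S assume S: "finite S" "symmetric_generating_set G S"
  interpret G: group G by fact
  interpret H: group H by fact
  let ?N = "G\<lparr>carrier := N\<rparr>"
  have Ng: "group ?N" using G.subgroup_imp_group[OF N] .
  interpret f: group_hom ?N H f using f Ng H by (simp add: group_hom_def group_hom_axioms_def)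
  define T where "T = word_ball G S 3 \<inter> N"
  have Sc: "S \<subseteq> carrier G" and sym: "\<And>s. s \<in> S \<Longrightarrow> inv\<^bsub>G\<^esub> s \<in> S"
    using S unfolding symmetric_generating_set_def by auto
  have genT: "generate ?N T = carrier ?N"
    using G.index_two_generators[OF S(2) N index] G.generate_consistent[of T N] N
    unfolding T_def by auto
  have TN: "T \<subseteq> N" unfolding T_def by blast
  have finT: "finite T" unfolding T_def using G.finite_word_ball[OF S(1)] by blast
  have invT: "inv\<^bsub>?N\<^esub> x \<in> T" if "x \<in> T" for x
  proof -
    have "inv\<^bsub>G\<^esub> x \<in> T"
      using that G.word_ball_inv[OF Sc sym] subgroup.m_inv_closed[OF N] unfolding T_def by blast
    then show ?thesis using G.m_inv_consistent[OF N] that TN by auto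
  qed
  have "symmetric_generating_set H (f ` T)"
    unfolding symmetric_generating_set_def
  proof (intro conjI ballI)
    show "f ` T \<subseteq> carrier H" using f(2) TN by blast
    show "generate H (f ` T) = carrier H"
      using f.generate_img[of T] genT TN f(2) by simp
    fix y assume "y \<in> f ` T"
    then obtain x where x: "x \<in> T" "y = f x" by blast
    then have "inv\<^bsub>H\<^esub> y = f (inv\<^bsub>?N\<^esub> x)" using f.hom_inv[of x] TN by auto
    then show "inv\<^bsub>H\<^esub> y \<in> f ` T" using invT x by blast
  qed
  then obtain K where K: "K > 0" "\<And>n. K * (d ^ 3) ^ n \<le> real (card (word_ball H (f ` T) n))"
    using ug finT unfolding uniform_growth_def by (meson finite_imageI)
  have "K * (d ^ 3) ^ n \<le> real (card (word_ball G S (3 * n)))" for n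
  proof -
    have "word_ball H (f ` T) n = f ` word_ball G T n"
      using hom_word_ball[OF Ng H f(1), of T n] TN by (simp add: word_ball_consistent)
    then have "card (word_ball H (f ` T) n) \<le> card (word_ball G T n)"
      using card_image_le[OF G.finite_word_ball[OF finT]] by metis
    also have "\<dots> \<le> card (word_ball G S (3 * n))"
      using G.word_ball_word_ball[OF Sc, of T 3 n] G.finite_word_ball[OF S(1)]
      by (intro card_mono) (auto simp: T_def)
    finally show ?thesis using K(2)[of n] by linarith
  qed
  then show "\<exists>K>0. \<forall>n. K * d ^ n \<le> real (card (word_ball G S n))"
    using G.growth_from_every_third_ball[OF S(1) d K(1)] by blast
qed

section \<open>Ping-pong on the real line\<close>

text \<open>Values \<open>Z\<close> of words of equal length differ by less than 2, hence by less
  than 1 after multiplication by r, and 1 is the gap between the digits. So the leading digits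
  agree, and r can be cancelled. Finite words keep the inequality strict, which admits the ratio
  1/2.\<close>

lemma digit_expansion_inj:
  fixes r :: real and v w :: "bool list"
  defines "Z \<equiv> (\<lambda>w. foldr (\<lambda>b z. r * z + (if b then 0 else 1)) w 0)"
  assumes r: "\<bar>r\<bar> \<le> 1 / 2" "r \<noteq> 0"
    and "length v = length w" "Z v = Z w"
  shows "v = w"
proof -
  have contract: "\<bar>r * x - r * y\<bar> < 1" if "\<bar>x - y\<bar> < 2" for x y
  proof -
    have "\<bar>r * (x - y)\<bar> \<le> 1 / 2 * \<bar>x - y\<bar>"
      unfolding abs_mult using r by (intro mult_right_mono) simp_all
    then show ?thesis using that by (simp add: right_diff_distrib)
  qed
  have Z_Cons: "Z (b # w) = r * Z w + (if b then 0 else 1)" for b w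
    unfolding Z_def by simp
  have bound: "\<bar>Z v - Z w\<bar> < 2" if "length v = length w" for v w
    using that
  proof (induction v w rule: list_induct2)
    case (Cons b v c w)
    then show ?case using contract[OF Cons.IH] by (auto simp: Z_Cons)
  qed simp
  show ?thesis
    using assms(4,5)
  proof (induction v w rule: list_induct2)
    case (Cons b v c w)
    then have "b = c" using contract[OF bound[OF Cons.hyps]] by (auto simp: Z_Cons split: if_splits)
    then show ?case using Cons r by (simp add: Z_Cons)
  qed simp
qed

text \<open>Ping-pong on the line: a contraction \<open>s\<close> of ratio \<open>r\<close>, \<open>\<bar>r\<bar> \<le> 1/2\<close>, and a conjugate of it
  with a different fixed point generate a free semigroup.\<close>

lemma (in group) uniform_growth_affine:
  fixes \<alpha> \<beta> :: "'a \<Rightarrow> real" and d :: real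
  assumes mult_\<alpha>: "\<And>x y. x \<in> carrier G \<Longrightarrow> y \<in> carrier G \<Longrightarrow> \<alpha> (x \<otimes> y) = \<alpha> x * \<alpha> y"
    and mult_\<beta>: "\<And>x y. x \<in> carrier G \<Longrightarrow> y \<in> carrier G \<Longrightarrow> \<beta> (x \<otimes> y) = \<alpha> x * \<beta> y + \<beta> x"
    and ratios: "\<And>x. x \<in> carrier G \<Longrightarrow> \<alpha> x \<noteq> 0 \<and> (\<bar>\<alpha> x\<bar> = 1 \<or> \<bar>\<alpha> x\<bar> \<le> 1 / 2 \<or> \<bar>\<alpha> x\<bar> \<ge> 2)"
    and hyperbolic: "\<exists>x\<in>carrier G. \<bar>\<alpha> x\<bar> \<noteq> 1"
    and noncomm: "\<exists>x\<in>carrier G. \<exists>y\<in>carrier G. \<beta> (x \<otimes> y) \<noteq> \<beta> (y \<otimes> x)"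
    and d: "d \<ge> 1" "d ^ 3 = 2"
  shows "uniform_growth G d"
  unfolding uniform_growth_def
proof (intro allI impI)
  fix S assume S: "finite S" "symmetric_generating_set G S"
  have Sc: "S \<subseteq> carrier G" and sym: "\<And>s. s \<in> S \<Longrightarrow> inv s \<in> S" and gen: "generate G S = carrier G"
    using S unfolding symmetric_generating_set_def by auto
  have \<alpha>_one: "\<alpha> \<one> = 1" using mult_\<alpha>[of \<one> \<one>] ratios[of \<one>] by simp
  have \<beta>_one: "\<beta> \<one> = 0" using mult_\<beta>[of \<one> \<one>] \<alpha>_one by simp
  have \<alpha>_inv: "\<alpha> (inv x) = 1 / \<alpha> x" if "x \<in> carrier G" for x
    using mult_\<alpha>[of x "inv x"] that \<alpha>_one ratios[OF that] by (simp add: field_simps)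
  have \<beta>_inv: "\<beta> (inv x) = - \<beta> x / \<alpha> x" if "x \<in> carrier G" for x
    using mult_\<beta>[of x "inv x"] that \<beta>_one ratios[OF that] by (simp add: field_simps add_eq_0_iff)
  have "\<exists>s\<in>S. \<bar>\<alpha> s\<bar> \<noteq> 1"
  proof (rule ccontr)
    assume "\<not> ?thesis"
    then have all: "\<bar>\<alpha> s\<bar> = 1" if "s \<in> S" for s using that by blast
    have "x \<in> carrier G \<and> \<bar>\<alpha> x\<bar> = 1" if "x \<in> generate G S" for x
      using that by induction (use all Sc in \<open>auto simp: \<alpha>_one \<alpha>_inv mult_\<alpha> abs_mult\<close>)
    then show False using hyperbolic gen by blast
  qed
  then obtain s0 where s0: "s0 \<in> S" "\<bar>\<alpha> s0\<bar> \<noteq> 1" by blast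
  \<comment> \<open>One of s0 and its inverse is a contraction, and the gap in \<open>ratios\<close>
    brings its ratio down to 1/2.\<close>
  have "\<exists>s\<in>S. \<bar>\<alpha> s\<bar> \<le> 1 / 2"
  proof (cases "\<bar>\<alpha> s0\<bar> \<le> 1 / 2")
    case False
    then have "\<bar>\<alpha> s0\<bar> \<ge> 2" using s0 ratios Sc by blast
    then have "\<bar>\<alpha> (inv s0)\<bar> \<le> 1 / 2" using s0 Sc by (subst \<alpha>_inv) (auto simp: field_simps)
    then show ?thesis using sym s0 by blast
  qed (use s0 in blast)
  then obtain s where s: "s \<in> S" "\<bar>\<alpha> s\<bar> \<le> 1 / 2" by blast
  define r where "r = \<alpha> s"
  define p where "p = \<beta> s / (1 - r)"
  have r: "\<bar>r\<bar> \<le> 1 / 2" "r \<noteq> 0" "1 - r \<noteq> 0" using s ratios Sc unfolding r_def by auto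
  have fix_s: "\<beta> s = (1 - r) * p" using r by (simp add: p_def)
  \<comment> \<open>If all generators fixed p, the fixed point of s, the whole group would. Then
    \<beta> is a function of the commutative quantity \<alpha>, which contradicts
    \<open>noncomm\<close>.\<close>
  have "\<exists>t\<in>S. \<alpha> t * p + \<beta> t \<noteq> p"
  proof (rule ccontr)
    assume "\<not> ?thesis"
    then have all: "\<beta> t = p - \<alpha> t * p" if "t \<in> S" for t using that by (metis add_diff_cancel_left')
    have "x \<in> carrier G \<and> \<beta> x = p - \<alpha> x * p" if "x \<in> generate G S" for x
      using that
    proof induction
      case (inv h)
      then show ?case using all Sc ratios[of h] by (auto simp: \<alpha>_inv \<beta>_inv diff_divide_distrib)
    next
      case (eng x y)
      then show ?case by (simp add: mult_\<alpha> mult_\<beta> right_diff_distrib)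
    qed (use all Sc in \<open>auto simp: \<alpha>_one \<beta>_one\<close>)
    then have "\<beta> (x \<otimes> y) = \<beta> (y \<otimes> x)" if "x \<in> carrier G" "y \<in> carrier G" for x y
      using that gen by (simp add: mult_\<beta> right_diff_distrib mult.left_commute mult_\<alpha>)
    then show False using noncomm by blast
  qed
  then obtain t where t: "t \<in> S" "\<alpha> t * p + \<beta> t \<noteq> p" by blast
  define q where "q = \<alpha> t * p + \<beta> t"
  \<comment> \<open>The conjugate has the ratio of s, and its fixed point is q, the image of p under
    t.\<close>
  define u where "u = t \<otimes> (s \<otimes> inv t)"
  have c: "s \<in> carrier G" "t \<in> carrier G" "u \<in> carrier G" using s t Sc unfolding u_def by auto
  have \<alpha>u: "\<alpha> u = r" using c ratios[of t] unfolding u_def r_def by (simp add: mult_\<alpha> \<alpha>_inv)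
  have \<beta>u: "\<beta> u = (1 - r) * q"
  proof -
    have "\<beta> u = \<alpha> t * (r * (- \<beta> t / \<alpha> t) + \<beta> s) + \<beta> t"
      using c unfolding u_def r_def by (simp add: mult_\<beta> \<beta>_inv)
    also have "\<dots> = (1 - r) * q"
      unfolding fix_s q_def using c ratios[of t] by (simp add: algebra_simps)
    finally show ?thesis .
  qed
  have ball1: "s \<in> word_ball G S 3"
    using generator_in_word_ball[OF Sc s(1)] word_ball_mono[of 1 3 S] by auto
  have ball2: "u \<in> word_ball G S 3"
    using word_ball_mult[OF Sc generator_in_word_ball[OF Sc t(1)]
        word_ball_mult[OF Sc generator_in_word_ball[OF Sc s(1)] generator_in_word_ball[OF Sc sym[OF t(1)]]]]
    unfolding u_def by (simp add: numeral_3_eq_3)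
  define F where "F w = foldr (\<otimes>) (map (\<lambda>b. if b then s else u) w) \<one>" for w
  define Z where "Z = (\<lambda>w. foldr (\<lambda>b z. r * z + (if b then 0 else 1)) w 0)"
  \<comment> \<open>The image of p under \<open>F w\<close>: each factor s is a digit 0 and each u a
    digit 1 of a base-r expansion, rescaled by (q - p) (1 - r).\<close>
  have F: "F w \<in> carrier G" "\<alpha> (F w) * p + \<beta> (F w) = p + (q - p) * (1 - r) * Z w" for w
  proof (induction w)
    case (Cons b w)
    { case 1 show ?case using Cons c by (simp add: F_def) }
    { case 2
      define g where "g = (if b then s else u)"
      have g: "g \<in> carrier G" "\<alpha> g = r" "\<beta> g = (1 - r) * (if b then p else q)"
        using c \<alpha>u \<beta>u fix_s by (auto simp: g_def r_def)
      have "\<alpha> (F (b # w)) * p + \<beta> (F (b # w)) = r * (\<alpha> (F w) * p + \<beta> (F w)) + \<beta> g"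
        using g Cons by (simp add: F_def mult_\<alpha> mult_\<beta> algebra_simps flip: g_def)
      also have "\<dots> = p + (q - p) * (1 - r) * Z (b # w)"
        unfolding Cons g Z_def by (simp add: algebra_simps)
      finally show ?case . }
  qed (simp_all add: F_def Z_def \<alpha>_one \<beta>_one)
  have "1 * (d ^ 3) ^ n \<le> real (card (word_ball G S (3 * n)))" for n
  proof -
    have "inj_on F {w. length w = n}"
    proof (rule inj_onI)
      fix v w assume vw: "v \<in> {w. length w = n}" "w \<in> {w. length w = n}" "F v = F w"
      then have "(q - p) * (1 - r) * Z v = (q - p) * (1 - r) * Z w" using F(2) by (metis add_left_cancel)
      then have "Z v = Z w" using r t unfolding q_def by simp
      then show "v = w" using digit_expansion_inj[OF r(1,2)] vw unfolding Z_def by simp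
    qed
    then have "card (F ` {w. length w = n}) = card {w :: bool list. length w = n}" by (rule card_image)
    also have "\<dots> = 2 ^ n" using card_lists_length_eq[of "UNIV :: bool set" n] by simp
    finally have "card (F ` {w. length w = n}) = 2 ^ n" .
    moreover have "F ` {w. length w = n} \<subseteq> word_ball G {s, u} n"
      unfolding F_def by (auto intro!: word_ballI)
    then have "F ` {w. length w = n} \<subseteq> word_ball G S (3 * n)"
      using word_ball_word_ball[OF Sc, of "{s, u}" 3 n] ball1 ball2 by blast
    then have "card (F ` {w. length w = n}) \<le> card (word_ball G S (3 * n))"
      using finite_word_ball[OF S(1)] by (simp add: card_mono)
    ultimately have "2 ^ n \<le> card (word_ball G S (3 * n))" by simp
    then have "real (2 ^ n) \<le> real (card (word_ball G S (3 * n)))" by (simp only: of_nat_le_iff)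
    then show ?thesis using d by simp
  qed
  then show "\<exists>K>0. \<forall>n. K * d ^ n \<le> real (card (word_ball G S n))"
    using growth_from_every_third_ball[OF S(1) d(1), of 1] by simp
qed

section \<open>Polycyclic subgroups\<close>

text \<open>The series grows from the trivial group upwards inside one ambient group, and cyclicity
  of \<open>L\<close> over \<open>M\<close> is expressed by elements. Inductions on the series thus
  avoid factor groups.\<close>

inductive polycyclic_in :: "('a, 'b) monoid_scheme \<Rightarrow> 'a set \<Rightarrow> bool" for G where
  trivial: "polycyclic_in G {\<one>\<^bsub>G\<^esub>}"
| cyclic_extension: "\<lbrakk>polycyclic_in G M; subgroup L G; M \<subseteq> L;
    \<And>g m. g \<in> L \<Longrightarrow> m \<in> M \<Longrightarrow> g \<otimes>\<^bsub>G\<^esub> m \<otimes>\<^bsub>G\<^esub> inv\<^bsub>G\<^esub> g \<in> M;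
    x \<in> L; \<And>g. g \<in> L \<Longrightarrow> \<exists>k::int. \<exists>m\<in>M. g = x [^]\<^bsub>G\<^esub> k \<otimes>\<^bsub>G\<^esub> m\<rbrakk>
    \<Longrightarrow> polycyclic_in G L"

lemma (in group) polycyclic_in_subgroup: "polycyclic_in G L \<Longrightarrow> subgroup L G"
  by (cases rule: polycyclic_in.cases) (auto simp: triv_subgroup)

lemma (in group) polycyclic_in_imp_polycyclic:
  assumes "polycyclic_in G (carrier G)"
  shows "polycyclic G"
proof -
  have "\<exists>(n :: nat) H. H 0 = L \<and> H n = {\<one>} \<and> (\<forall>i\<le>n. subgroup (H i) G) \<and>
      (\<forall>i<n. H (Suc i) \<lhd> G\<lparr>carrier := H i\<rparr> \<and> cyclic_group (G\<lparr>carrier := H i\<rparr> Mod H (Suc i)))"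
    if "polycyclic_in G L" for L
    using that
  proof induction
    case trivial
    show ?case by (intro exI[of _ 0] exI[of _ "\<lambda>_. {\<one>}"]) (simp add: triv_subgroup)
  next
    case (cyclic_extension M L x)
    let ?L = "G\<lparr>carrier := L\<rparr>"
    interpret L: group "?L" using subgroup_imp_group[OF cyclic_extension.hyps(2)] .
    have sub_M: "subgroup M ?L"
      using subgroup_incl[OF polycyclic_in_subgroup[OF cyclic_extension.hyps(1)]] cyclic_extension.hyps(2,3)
      by blast
    have nM: "M \<lhd> ?L"
      using cyclic_extension.hyps by (intro L.normal_invI[OF sub_M]) (auto simp: m_inv_consistent)
    interpret normal M "?L" by fact
    interpret Q: group "?L Mod M" by (rule factorgroup_is_group)
    have hom: "(\<lambda>a. M #>\<^bsub>?L\<^esub> a) \<in> hom ?L (?L Mod M)" by (rule r_coset_hom_Mod)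
    have pow: "(M #>\<^bsub>?L\<^esub> x) [^]\<^bsub>?L Mod M\<^esub> k = M #>\<^bsub>?L\<^esub> (x [^]\<^bsub>?L\<^esub> k)" for k :: int
      using hom_int_pow[OF hom, of x k] L.group_axioms Q.group_axioms cyclic_extension.hyps(5) by simp
    have "carrier (?L Mod M) = range (\<lambda>k::int. (M #>\<^bsub>?L\<^esub> x) [^]\<^bsub>?L Mod M\<^esub> k)"
    proof
      show "carrier (?L Mod M) \<subseteq> range (\<lambda>k::int. (M #>\<^bsub>?L\<^esub> x) [^]\<^bsub>?L Mod M\<^esub> k)"
      proof
        fix c assume "c \<in> carrier (?L Mod M)"
        then obtain g where g: "g \<in> L" "c = M #>\<^bsub>?L\<^esub> g" by (auto simp: FactGroup_def RCOSETS_def)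
        obtain k :: int and m where m: "m \<in> M" "g = x [^] k \<otimes> m"
          using cyclic_extension.hyps(6)[OF g(1)] by blast
        have xk: "x [^]\<^bsub>?L\<^esub> k = x [^] k"
          using int_pow_consistent[OF cyclic_extension.hyps(2,5), of k] by simp
        have xL: "x [^]\<^bsub>?L\<^esub> k \<in> L" using L.int_pow_closed[of x k] cyclic_extension.hyps(5) by simp
        \<comment> \<open>The hypothesis puts g in a left coset of \<open>M\<close>, whereas
          \<open>Mod\<close> consists of right cosets; normality exchanges them.\<close>
        have "g \<in> x [^]\<^bsub>?L\<^esub> k <#\<^bsub>?L\<^esub> M" using m xk by (auto simp: l_coset_def)
        then have "g \<in> M #>\<^bsub>?L\<^esub> (x [^]\<^bsub>?L\<^esub> k)" using coset_eq xL by auto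
        then have "c = M #>\<^bsub>?L\<^esub> (x [^]\<^bsub>?L\<^esub> k)" using g L.repr_independence[OF _ _ sub_M] xL by simp
        then show "c \<in> range (\<lambda>k::int. (M #>\<^bsub>?L\<^esub> x) [^]\<^bsub>?L Mod M\<^esub> k)" using pow by blast
      qed
      have "M #>\<^bsub>?L\<^esub> x \<in> carrier (?L Mod M)" using hom cyclic_extension.hyps(5) by (auto simp: hom_def)
      then show "range (\<lambda>k::int. (M #>\<^bsub>?L\<^esub> x) [^]\<^bsub>?L Mod M\<^esub> k) \<subseteq> carrier (?L Mod M)"
        using Q.int_pow_closed by blast
    qed
    moreover have "M #>\<^bsub>?L\<^esub> x \<in> carrier (?L Mod M)" using hom cyclic_extension.hyps(5) by (auto simp: hom_def)
    ultimately have cyc: "cyclic_group (?L Mod M)" using Q.cyclic_group by blast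
    obtain n :: nat and H where H: "H 0 = M" "H n = {\<one>}" "\<forall>i\<le>n. subgroup (H i) G"
      "\<forall>i<n. H (Suc i) \<lhd> G\<lparr>carrier := H i\<rparr> \<and> cyclic_group (G\<lparr>carrier := H i\<rparr> Mod H (Suc i))"
      using cyclic_extension.IH by blast
    define H' where "H' = case_nat L H"
    have "\<forall>i\<le>Suc n. subgroup (H' i) G"
      using H(3) cyclic_extension.hyps(2) by (auto simp: H'_def split: nat.split)
    moreover have "H' (Suc i) \<lhd> G\<lparr>carrier := H' i\<rparr> \<and> cyclic_group (G\<lparr>carrier := H' i\<rparr> Mod H' (Suc i))"
      if "i < Suc n" for i
    proof (cases i)
      case 0
      then show ?thesis using H(1) cyc nM by (simp add: H'_def)
    next
      case (Suc j)
      then show ?thesis using H(4) that by (simp add: H'_def)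
    qed
    moreover have "H' 0 = L" "H' (Suc n) = {\<one>}" using H(2) by (simp_all add: H'_def)
    ultimately show ?case by blast
  qed
  then show ?thesis using assms unfolding polycyclic_def by blast
qed

text \<open>The least positive element d works, as k mod d stays in \<open>I\<close>. It is applied
  below to a group of exponents.\<close>

lemma int_subgroup_cyclic:
  fixes I :: "int set"
  assumes diff: "\<And>k l. k \<in> I \<Longrightarrow> l \<in> I \<Longrightarrow> k - l \<in> I" and "0 \<in> I"
  shows "\<exists>d\<in>I. \<forall>k\<in>I. d dvd k"
proof (cases "\<exists>k\<in>I. k \<noteq> 0")
  case True
  have neg: "- k \<in> I" if "k \<in> I" for k using diff[OF \<open>0 \<in> I\<close> that] by simp
  have add: "k + l \<in> I" if "k \<in> I" "l \<in> I" for k l using diff[OF that(1) neg[OF that(2)]] by simp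
  have mult: "int n * k \<in> I" if "k \<in> I" for n k
    by (induction n) (use add that \<open>0 \<in> I\<close> in \<open>auto simp: algebra_simps\<close>)
  have mult': "j * k \<in> I" if "k \<in> I" for j k
    using mult[OF that, of "nat j"] neg[OF mult[OF that, of "nat (- j)"]] by (cases "j \<ge> 0") auto
  obtain k where "k \<in> I" "k \<noteq> 0" using True by blast
  then have ex: "nat \<bar>k\<bar> > 0 \<and> int (nat \<bar>k\<bar>) \<in> I" using neg by (auto simp: abs_if)
  define n where "n = (LEAST n. n > 0 \<and> int n \<in> I)"
  have n: "n > 0" "int n \<in> I" using LeastI[of "\<lambda>n. n > 0 \<and> int n \<in> I", OF ex] by (simp_all add: n_def)
  have min: "n \<le> m" if "m > 0" "int m \<in> I" for m
    unfolding n_def using that by (intro Least_le) simp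
  have "int n dvd k" if "k \<in> I" for k
  proof (rule ccontr)
    assume "\<not> int n dvd k"
    then have "k mod int n > 0" using n by (simp add: dvd_eq_mod_eq_0 order.not_eq_order_implies_strict)
    moreover have "k mod int n \<in> I"
      using diff[OF that mult'[OF n(2), of "k div int n"]] by (simp add: minus_div_mult_eq_mod)
    ultimately have "n \<le> nat (k mod int n)" using min[of "nat (k mod int n)"] by simp
    moreover have "k mod int n < int n" using n by simp
    ultimately show False using \<open>k mod int n > 0\<close> by linarith
  qed
  then show ?thesis using n by blast
qed (use \<open>0 \<in> I\<close> in auto)

text \<open>This covers extensions and, when the kernel is trivial, subgroups. The obstacle is that
  \<open>f\<close> may miss the generator \<open>x\<close> of a cyclic step. The exponents k for
  which the coset of x^k meets the image form a subgroup of the integers; a preimage belonging to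
  its generator then generates the step of the new series.\<close>

lemma polycyclic_in_vimage:
  assumes G: "group G" and N: "subgroup N G" and K: "group K" and f: "f \<in> hom (G\<lparr>carrier := N\<rparr>) K"
    and ker: "polycyclic_in G {g \<in> N. f g = \<one>\<^bsub>K\<^esub>}" and L: "polycyclic_in K L"
  shows "polycyclic_in G {g \<in> N. f g \<in> L}"
  using L
proof induction
  case trivial
  then show ?case using ker by simp
next
  case (cyclic_extension M L x)
  interpret G: group G by fact
  interpret K: group K by fact
  interpret N: subgroup N G by fact
  let ?N = "G\<lparr>carrier := N\<rparr>"
  interpret f: group_hom ?N K f
    using f K G.subgroup_imp_group[OF N] by (simp add: group_hom_def group_hom_axioms_def)
  interpret M: subgroup M K using K.polycyclic_in_subgroup[OF cyclic_extension.hyps(1)] .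
  interpret L: subgroup L K using cyclic_extension.hyps(2) .
  note normal = cyclic_extension.hyps(4) and xL = cyclic_extension.hyps(5)
  have x: "x \<in> carrier K" using xL L.subset by blast
  have f_mult: "f (g \<otimes>\<^bsub>G\<^esub> h) = f g \<otimes>\<^bsub>K\<^esub> f h" if "g \<in> N" "h \<in> N" for g h
    using f.hom_mult[of g h] that by simp
  have f_inv: "f (inv\<^bsub>G\<^esub> g) = inv\<^bsub>K\<^esub> f g" if "g \<in> N" for g
    using f.hom_inv[of g] that G.m_inv_consistent[OF N, of g] by simp
  have f_pow: "f (g [^]\<^bsub>G\<^esub> j) = f g [^]\<^bsub>K\<^esub> j" "g [^]\<^bsub>G\<^esub> j \<in> N" if "g \<in> N" for g and j :: int
    using f.hom_int_pow[of g j] that G.int_pow_consistent[OF N, of g j] f.int_pow_closed[of g j] by simp_all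
  \<comment> \<open>\<open>R k h\<close> places h in the coset of x^k modulo \<open>M\<close>. It is
    a relation because h does not determine k when x has finite order modulo \<open>M\<close>; it is
    nevertheless compatible with products and inverses.\<close>
  define R where "R k h \<longleftrightarrow> (\<exists>m\<in>M. h = x [^]\<^bsub>K\<^esub> k \<otimes>\<^bsub>K\<^esub> m)" for k :: int and h
  have R_diff: "R (k - l) (h \<otimes>\<^bsub>K\<^esub> inv\<^bsub>K\<^esub> h')" if kh: "R k h" and lh: "R l h'" for k l h h'
  proof -
    obtain m m' where m: "m \<in> M" "h = x [^]\<^bsub>K\<^esub> k \<otimes>\<^bsub>K\<^esub> m" and m': "m' \<in> M" "h' = x [^]\<^bsub>K\<^esub> l \<otimes>\<^bsub>K\<^esub> m'"
      using kh lh unfolding R_def by blast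
    define y where "y = x [^]\<^bsub>K\<^esub> l"
    have y: "y \<in> carrier K" "y \<in> L"
      using x xL K.subgroup_int_pow_closed[OF cyclic_extension.hyps(2)] by (auto simp: y_def)
    have "h \<otimes>\<^bsub>K\<^esub> inv\<^bsub>K\<^esub> h' = x [^]\<^bsub>K\<^esub> k \<otimes>\<^bsub>K\<^esub> (m \<otimes>\<^bsub>K\<^esub> inv\<^bsub>K\<^esub> m') \<otimes>\<^bsub>K\<^esub> inv\<^bsub>K\<^esub> y"
      using m m' x y by (simp add: K.inv_mult_group K.m_assoc flip: y_def)
    also have "x [^]\<^bsub>K\<^esub> k = x [^]\<^bsub>K\<^esub> (k - l) \<otimes>\<^bsub>K\<^esub> y"
      using x unfolding y_def by (simp flip: K.int_pow_mult)
    finally have "h \<otimes>\<^bsub>K\<^esub> inv\<^bsub>K\<^esub> h' = x [^]\<^bsub>K\<^esub> (k - l) \<otimes>\<^bsub>K\<^esub> (y \<otimes>\<^bsub>K\<^esub> (m \<otimes>\<^bsub>K\<^esub> inv\<^bsub>K\<^esub> m') \<otimes>\<^bsub>K\<^esub> inv\<^bsub>K\<^esub> y)"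
      using m m' x y by (simp add: K.m_assoc)
    moreover have "y \<otimes>\<^bsub>K\<^esub> (m \<otimes>\<^bsub>K\<^esub> inv\<^bsub>K\<^esub> m') \<otimes>\<^bsub>K\<^esub> inv\<^bsub>K\<^esub> y \<in> M"
      using m m' y by (intro normal) auto
    ultimately show ?thesis unfolding R_def by blast
  qed
  have R_one: "R 0 \<one>\<^bsub>K\<^esub>" unfolding R_def by (intro bexI[of _ "\<one>\<^bsub>K\<^esub>"]) auto
  have R_closed: "h \<in> carrier K" if "R k h" for k h
    using that x unfolding R_def by auto
  have R_inv: "R (- k) (inv\<^bsub>K\<^esub> h)" if "R k h" for k h
    using R_diff[OF R_one that] R_closed[OF that] by simp
  have R_add: "R (k + l) (h \<otimes>\<^bsub>K\<^esub> h')" if "R k h" "R l h'" for k l h h'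
    using R_diff[OF that(1) R_inv[OF that(2)]] R_closed[OF that(2)] by simp
  have R_nat_pow: "R (int n * k) (h [^]\<^bsub>K\<^esub> n)" if "R k h" for k h n
  proof (induction n)
    case (Suc n)
    then show ?case using R_add[OF Suc that] by (simp add: algebra_simps)
  qed (simp add: R_one)
  have R_pow: "R (j * k) (h [^]\<^bsub>K\<^esub> j)" if "R k h" for k h and j :: int
  proof (cases "j \<ge> 0")
    case True
    then show ?thesis using R_nat_pow[OF that, of "nat j"] by (metis int_nat_eq int_pow_int)
  next
    case False
    then have "R (- (- j * k)) (inv\<^bsub>K\<^esub> (h [^]\<^bsub>K\<^esub> (- j)))"
      using R_inv[OF R_nat_pow[OF that, of "nat (- j)"]] by (metis int_nat_eq int_pow_int linorder_le_cases neg_0_le_iff_le)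
    then show ?thesis using R_closed[OF that] by (simp add: K.int_pow_neg)
  qed
  have R_eq: "inv\<^bsub>K\<^esub> h \<otimes>\<^bsub>K\<^esub> h' \<in> M" if kh: "R k h" and kh': "R k h'" for k h h'
  proof -
    obtain m where m: "m \<in> M" "h = x [^]\<^bsub>K\<^esub> k \<otimes>\<^bsub>K\<^esub> m" using kh unfolding R_def by blast
    obtain m' where m': "m' \<in> M" "h' = x [^]\<^bsub>K\<^esub> k \<otimes>\<^bsub>K\<^esub> m'" using kh' unfolding R_def by blast
    have "inv\<^bsub>K\<^esub> h \<otimes>\<^bsub>K\<^esub> h' = inv\<^bsub>K\<^esub> m \<otimes>\<^bsub>K\<^esub> m'"
    proof -
      have "inv\<^bsub>K\<^esub> (x [^]\<^bsub>K\<^esub> k) \<otimes>\<^bsub>K\<^esub> (x [^]\<^bsub>K\<^esub> k \<otimes>\<^bsub>K\<^esub> m') = m'"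
        using x m' by (simp flip: K.m_assoc)
      then show ?thesis using m m' x by (simp add: K.inv_mult_group K.m_assoc)
    qed
    then show ?thesis using m m' by simp
  qed
  define P where "P = {g \<in> N. f g \<in> L}"
  define P' where "P' = {g \<in> N. f g \<in> M}"
  have P: "subgroup P G"
  proof (rule G.subgroupI)
    show "P \<subseteq> carrier G" unfolding P_def using N.subset by blast
    have "\<one>\<^bsub>G\<^esub> \<in> P" unfolding P_def using f.hom_one by simp
    then show "P \<noteq> {}" by blast
  qed (auto simp: P_def f_mult f_inv)
  define I where "I = {k. \<exists>g\<in>P. R k (f g)}"
  have "k - l \<in> I" if kI: "k \<in> I" and lI: "l \<in> I" for k l
  proof -
    obtain g h where g: "g \<in> P" "R k (f g)" and h: "h \<in> P" "R l (f h)" using kI lI unfolding I_def by blast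
    have "g \<otimes>\<^bsub>G\<^esub> inv\<^bsub>G\<^esub> h \<in> P" using g h P by (simp add: subgroup.m_closed subgroup.m_inv_closed)
    moreover have "R (k - l) (f (g \<otimes>\<^bsub>G\<^esub> inv\<^bsub>G\<^esub> h))"
      using R_diff[OF g(2) h(2)] g h by (simp add: P_def f_mult f_inv)
    ultimately show ?thesis unfolding I_def by blast
  qed
  moreover have "0 \<in> I"
    using R_one subgroup.one_closed[OF P] f.hom_one unfolding I_def by force
  ultimately obtain d where d: "d \<in> I" "\<And>k. k \<in> I \<Longrightarrow> d dvd k" using int_subgroup_cyclic by metis
  then obtain g0 where g0: "g0 \<in> P" "R d (f g0)" unfolding I_def by blast
  have "polycyclic_in G P"
  proof (rule polycyclic_in.cyclic_extension[where M = P' and x = g0])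
    show "polycyclic_in G P'" unfolding P'_def using cyclic_extension.IH .
    show "subgroup P G" by fact
    show "P' \<subseteq> P" unfolding P_def P'_def using cyclic_extension.hyps(3) by blast
    show "g0 \<in> P" by fact
    show "g \<otimes>\<^bsub>G\<^esub> m \<otimes>\<^bsub>G\<^esub> inv\<^bsub>G\<^esub> g \<in> P'" if "g \<in> P" "m \<in> P'" for g m
      using that normal unfolding P_def P'_def by (auto simp: f_mult f_inv)
    show "\<exists>k::int. \<exists>m\<in>P'. g = g0 [^]\<^bsub>G\<^esub> k \<otimes>\<^bsub>G\<^esub> m" if g: "g \<in> P" for g
    proof -
      obtain k where k: "R k (f g)"
        using cyclic_extension.hyps(6)[of "f g"] g unfolding R_def P_def by blast
      then have "d dvd k" using g d(2) unfolding I_def by blast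
      then obtain j where j: "k = j * d" by (metis dvd_def mult.commute)
      define u where "u = g0 [^]\<^bsub>G\<^esub> j"
      have u: "u \<in> N" "f u = f g0 [^]\<^bsub>K\<^esub> j" using f_pow g0 unfolding u_def P_def by auto
      have "inv\<^bsub>K\<^esub> f u \<otimes>\<^bsub>K\<^esub> f g \<in> M" using R_eq R_pow[OF g0(2), of j] k j u by simp
      then have "inv\<^bsub>G\<^esub> u \<otimes>\<^bsub>G\<^esub> g \<in> P'" using u g unfolding P_def P'_def by (simp add: f_mult f_inv)
      moreover have "g = u \<otimes>\<^bsub>G\<^esub> (inv\<^bsub>G\<^esub> u \<otimes>\<^bsub>G\<^esub> g)"
        using u g unfolding P_def by (simp flip: G.m_assoc)
      ultimately show ?thesis unfolding u_def by blast
    qed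
  qed
  then show ?case unfolding P_def .
qed

section \<open>Virtually metabelian groups\<close>

text \<open>Finite index is expressed by a map with finitely many values that separates the right cosets.\<close>

definition virtually_metabelian_map :: "('a, 'b) monoid_scheme \<Rightarrow> 'a set \<Rightarrow> ('a \<Rightarrow> nat) \<Rightarrow> bool" where
  "virtually_metabelian_map G M col \<longleftrightarrow>
     subgroup M G \<and> finite (col ` carrier G) \<and>
     (\<forall>x\<in>carrier G. \<forall>y\<in>carrier G. col x = col y \<longrightarrow> x \<otimes>\<^bsub>G\<^esub> inv\<^bsub>G\<^esub> y \<in> M) \<and>
     (\<forall>x\<in>derived_set G M. \<forall>y\<in>derived_set G M. x \<otimes>\<^bsub>G\<^esub> y = y \<otimes>\<^bsub>G\<^esub> x)"

text \<open>Centralizers are subgroups; this is used once for each factor. It reduces commutativity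
  of a derived subgroup to that of single commutators, which is what
  \<open>virtually_metabelian_map\<close> records.\<close>

lemma (in group) commute_generate:
  assumes A: "A \<subseteq> carrier G" and comm: "\<And>x y. x \<in> A \<Longrightarrow> y \<in> A \<Longrightarrow> x \<otimes> y = y \<otimes> x"
    and x: "x \<in> generate G A" and y: "y \<in> generate G A"
  shows "x \<otimes> y = y \<otimes> x"
proof -
  have centralizer: "g \<otimes> z = z \<otimes> g"
    if "z \<in> carrier G" "\<And>a. a \<in> A \<Longrightarrow> a \<otimes> z = z \<otimes> a" "g \<in> generate G A" for g z
    using that(3)
  proof induction
    case (inv h)
    then have h: "h \<in> carrier G" "h \<otimes> z = z \<otimes> h" using A that by auto
    then have "inv h \<otimes> z = inv h \<otimes> (z \<otimes> h) \<otimes> inv h" using that(1) by (simp add: m_assoc)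
    also have "\<dots> = inv h \<otimes> (h \<otimes> z) \<otimes> inv h" using h by simp
    also have "\<dots> = z \<otimes> inv h" using h(1) that(1) by (simp flip: m_assoc)
    finally show ?case .
  next
    case (eng h k)
    then have "h \<in> carrier G" "k \<in> carrier G" using generate_in_carrier[OF A] by auto
    then show ?case using eng that(1) by (metis m_assoc)
  qed (use that in auto)
  have "a \<otimes> y = y \<otimes> a" if "a \<in> A" for a
    using centralizer[of a y] that A comm y by auto
  then show ?thesis using centralizer[of y x] generate_in_carrier[OF A y] x by blast
qed

lemma virtually_metabelian_mapD:
  assumes G: "group G" and M: "virtually_metabelian_map G M col"
  shows "virtually_metabelian G"
proof -
  interpret G: group G by fact
  have sub: "subgroup M G" and fin: "finite (col ` carrier G)"
    and col: "\<And>x y. x \<in> carrier G \<Longrightarrow> y \<in> carrier G \<Longrightarrow> col x = col y \<Longrightarrow> x \<otimes>\<^bsub>G\<^esub> inv\<^bsub>G\<^esub> y \<in> M"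
    and comm: "\<And>x y. x \<in> derived_set G M \<Longrightarrow> y \<in> derived_set G M \<Longrightarrow> x \<otimes>\<^bsub>G\<^esub> y = y \<otimes>\<^bsub>G\<^esub> x"
    using M unfolding virtually_metabelian_map_def by blast+
  let ?M = "G\<lparr>carrier := M\<rparr>"
  interpret M: group "?M" using G.subgroup_imp_group[OF sub] .
  have "finite (rcosets\<^bsub>G\<^esub> M)"
  proof -
    \<comment> \<open>With one representative chosen per colour, every coset is the coset of a
      representative, so there are at most as many cosets as colours.\<close>
    define rep where "rep i = (SOME y. y \<in> carrier G \<and> col y = i)" for i
    have "M #>\<^bsub>G\<^esub> x \<in> (\<lambda>i. M #>\<^bsub>G\<^esub> rep i) ` col ` carrier G" if x: "x \<in> carrier G" for x
    proof -
      have r: "rep (col x) \<in> carrier G \<and> col (rep (col x)) = col x"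
        unfolding rep_def using x by (metis (mono_tags, lifting) someI)
      then have "x \<in> M #>\<^bsub>G\<^esub> rep (col x)"
        using col[of x "rep (col x)"] x r_coset_def[of G]
        by (auto intro!: bexI[of _ "x \<otimes>\<^bsub>G\<^esub> inv\<^bsub>G\<^esub> rep (col x)"] simp: G.m_assoc)
      then have "M #>\<^bsub>G\<^esub> rep (col x) = M #>\<^bsub>G\<^esub> x" using G.repr_independence[OF _ _ sub] r by simp
      then show ?thesis using x by force
    qed
    then have "rcosets\<^bsub>G\<^esub> M \<subseteq> (\<lambda>i. M #>\<^bsub>G\<^esub> rep i) ` col ` carrier G" unfolding RCOSETS_def by blast
    then show ?thesis using fin by (meson finite_imageI finite_subset)
  qed
  moreover have "metabelian ?M"
  proof -
    have dset: "derived_set ?M M = derived_set G M" using G.m_inv_consistent[OF sub] by simp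
    have dM: "derived_set G M \<subseteq> M" using G.derived_set_incl[OF order_refl sub] .
    have gen: "derived ?M M = generate G (derived_set G M)"
      unfolding derived_def dset using G.generate_consistent[OF dM sub] .
    have "subgroup (derived ?M M) ?M" using M.derived_is_subgroup[of M] by simp
    then interpret D: group "?M\<lparr>carrier := derived ?M M\<rparr>" by (rule M.subgroup_imp_group)
    have "x \<otimes>\<^bsub>G\<^esub> y = y \<otimes>\<^bsub>G\<^esub> x" if "x \<in> derived ?M M" "y \<in> derived ?M M" for x y
      by (rule G.commute_generate[OF subset_trans[OF dM subgroup.subset[OF sub]] comm])
        (use that gen in \<open>simp_all only:\<close>)
    then have "comm_group (?M\<lparr>carrier := derived ?M M\<rparr>)"
      by (intro D.group_comm_groupI) simp
    then show ?thesis unfolding metabelian_def by simp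
  qed
  ultimately show ?thesis using sub unfolding virtually_metabelian_def by blast
qed

text \<open>\<open>f\<close> sends commutators to commutators, and injectivity reflects that they
  commute. Colours are pulled back along \<open>f\<close>.\<close>

lemma virtually_metabelian_map_vimage:
  assumes G: "group G" and K: "group K" and f: "f \<in> hom G K" "inj_on f (carrier G)"
    and M: "virtually_metabelian_map K M col"
  shows "virtually_metabelian_map G {g \<in> carrier G. f g \<in> M} (col \<circ> f)"
proof -
  interpret f: group_hom G K f using assms by (simp add: group_hom_def group_hom_axioms_def)
  have sub: "subgroup M K" and fin: "finite (col ` carrier K)"
    and col: "\<And>x y. x \<in> carrier K \<Longrightarrow> y \<in> carrier K \<Longrightarrow> col x = col y \<Longrightarrow> x \<otimes>\<^bsub>K\<^esub> inv\<^bsub>K\<^esub> y \<in> M"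
    and comm: "\<And>x y. x \<in> derived_set K M \<Longrightarrow> y \<in> derived_set K M \<Longrightarrow> x \<otimes>\<^bsub>K\<^esub> y = y \<otimes>\<^bsub>K\<^esub> x"
    using M unfolding virtually_metabelian_map_def by blast+
  interpret M: subgroup M K by fact
  let ?P = "{g \<in> carrier G. f g \<in> M}"
  have der: "f x \<in> derived_set K M \<and> x \<in> carrier G" if "x \<in> derived_set G ?P" for x
    using that by force
  show ?thesis
    unfolding virtually_metabelian_map_def
  proof (intro conjI ballI impI)
    show "subgroup ?P G"
    proof (rule f.G.subgroupI)
      show "?P \<noteq> {}" using f.G.one_closed by force
    qed auto
    have "(col \<circ> f) ` carrier G \<subseteq> col ` carrier K" by auto
    then show "finite ((col \<circ> f) ` carrier G)" using fin by (rule finite_subset)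
    show "x \<otimes>\<^bsub>G\<^esub> inv\<^bsub>G\<^esub> y \<in> ?P"
      if "x \<in> carrier G" "y \<in> carrier G" "(col \<circ> f) x = (col \<circ> f) y" for x y
      using that col[of "f x" "f y"] by auto
    show "x \<otimes>\<^bsub>G\<^esub> y = y \<otimes>\<^bsub>G\<^esub> x" if xy: "x \<in> derived_set G ?P" "y \<in> derived_set G ?P" for x y
    proof -
      have x: "x \<in> carrier G" "f x \<in> derived_set K M" and y: "y \<in> carrier G" "f y \<in> derived_set K M"
        using der[OF xy(1)] der[OF xy(2)] by blast+
      have "f (x \<otimes>\<^bsub>G\<^esub> y) = f x \<otimes>\<^bsub>K\<^esub> f y" "f (y \<otimes>\<^bsub>G\<^esub> x) = f y \<otimes>\<^bsub>K\<^esub> f x"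
        using f.hom_mult[OF x(1) y(1)] f.hom_mult[OF y(1) x(1)] .
      then have "f (x \<otimes>\<^bsub>G\<^esub> y) = f (y \<otimes>\<^bsub>G\<^esub> x)" using comm[OF x(2) y(2)] by (simp only:)
      then show ?thesis using x(1) y(1) by (intro inj_onD[OF f(2)]) (simp_all only: f.G.m_closed)
    qed
  qed
qed

section \<open>Groups generated by an involution and a Klein four-group\<close>

datatype letter = La | Lb | Lc | Ld

lemma UNIV_letter: "UNIV = {La, Lb, Lc, Ld}"
  using letter.exhaust by auto

instance letter :: finite
  by standard (simp add: UNIV_letter)

definition eval_word :: "('a, 'b) monoid_scheme \<Rightarrow> (letter \<Rightarrow> 'a) \<Rightarrow> letter list \<Rightarrow> 'a" where
  "eval_word G e w = foldr (\<lambda>x g. e x \<otimes>\<^bsub>G\<^esub> g) w \<one>\<^bsub>G\<^esub>"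

lemma eval_word_simps [simp]:
  "eval_word G e [] = \<one>\<^bsub>G\<^esub>"
  "eval_word G e (x # w) = e x \<otimes>\<^bsub>G\<^esub> eval_word G e w"
  by (simp_all add: eval_word_def)

lemma eval_word_foldr: "eval_word G e w = foldr (\<otimes>\<^bsub>G\<^esub>) (map e w) \<one>\<^bsub>G\<^esub>"
  by (simp add: eval_word_def foldr_map comp_def)

text \<open>In the last clause x, y, z are b, c, d in any order. The clauses are the relations of
  the free product of Z/2 and a Klein four-group; the group may satisfy more.\<close>

definition klein_marking :: "('a, 'b) monoid_scheme \<Rightarrow> (letter \<Rightarrow> 'a) \<Rightarrow> bool" where
  "klein_marking G e \<longleftrightarrow> range e \<subseteq> carrier G \<and> (\<forall>x. e x \<otimes>\<^bsub>G\<^esub> e x = \<one>\<^bsub>G\<^esub>) \<and>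
     (\<forall>x y z. distinct [La, x, y, z] \<longrightarrow> e x \<otimes>\<^bsub>G\<^esub> e y = e z)"

lemma klein_markingI:
  assumes "\<And>x. e x \<in> carrier G" "\<And>x. e x \<otimes>\<^bsub>G\<^esub> e x = \<one>\<^bsub>G\<^esub>"
    "e Lb \<otimes>\<^bsub>G\<^esub> e Lc = e Ld" "e Lc \<otimes>\<^bsub>G\<^esub> e Lb = e Ld" "e Lb \<otimes>\<^bsub>G\<^esub> e Ld = e Lc"
    "e Ld \<otimes>\<^bsub>G\<^esub> e Lb = e Lc" "e Lc \<otimes>\<^bsub>G\<^esub> e Ld = e Lb" "e Ld \<otimes>\<^bsub>G\<^esub> e Lc = e Lb"
  shows "klein_marking G e"
  unfolding klein_marking_def
proof (intro conjI allI impI)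
  fix x y z assume "distinct [La, x, y, z]"
  then show "e x \<otimes>\<^bsub>G\<^esub> e y = e z"
    using assms(3-) by (cases x; cases y; cases z) simp_all
qed (use assms(1,2) in auto)

lemma klein_markingD:
  assumes "klein_marking G e"
  shows "e x \<in> carrier G" "e x \<otimes>\<^bsub>G\<^esub> e x = \<one>\<^bsub>G\<^esub>"
    "distinct [La, y, z, t] \<Longrightarrow> e y \<otimes>\<^bsub>G\<^esub> e z = e t"
  using assms unfolding klein_marking_def by blast+

lemma (in group) eval_word_closed: "range e \<subseteq> carrier G \<Longrightarrow> eval_word G e w \<in> carrier G"
  by (induction w) auto

lemma (in group) eval_word_append:
  "range e \<subseteq> carrier G \<Longrightarrow> eval_word G e (v @ w) = eval_word G e v \<otimes> eval_word G e w"
  by (induction v) (auto simp: eval_word_closed m_assoc range_subsetD)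

text \<open>The generators are involutions, so a reversed word evaluates to the inverse.\<close>

lemma (in group) eval_word_subgroup:
  assumes e: "range e \<subseteq> carrier G" "\<And>x. e x \<otimes> e x = \<one>"
  shows "subgroup (range (eval_word G e)) G"
proof (rule subgroupI)
  show "range (eval_word G e) \<subseteq> carrier G" using eval_word_closed[OF e(1)] by blast
  have "inv (eval_word G e w) = eval_word G e (rev w)" for w
  proof (induction w)
    case (Cons x w)
    have x: "e x \<in> carrier G" "inv (e x) = e x" using e by (auto intro: inv_equality)
    then show ?case using Cons eval_word_closed[OF e(1)] by (simp add: inv_mult_group eval_word_append[OF e(1)])
  qed simp
  then show "inv g \<in> range (eval_word G e)" if "g \<in> range (eval_word G e)" for g
    using that by auto
  show "g \<otimes> h \<in> range (eval_word G e)"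
    if "g \<in> range (eval_word G e)" "h \<in> range (eval_word G e)" for g h
    using that by (auto simp flip: eval_word_append[OF e(1)])
qed simp

text \<open>A rational version of the weights used by Bartholdi for the Grigorchuk group. Besides the
  triangle inequality for the letters b, c, d, all that matters is that replacing the pair a, x
  by the letters in the coordinates of x (b by a, c; c by a, d; d by b) multiplies the weight by
  at most \<open>5/6\<close>.\<close>

fun weight :: "letter \<Rightarrow> nat" where
  "weight La = 3" | "weight Lb = 3" | "weight Lc = 2" | "weight Ld = 1"

definition word_weight :: "letter list \<Rightarrow> nat" where
  "word_weight w = sum_list (map weight w)"

lemma word_weight_simps [simp]:
  "word_weight [] = 0"
  "word_weight (x # w) = weight x + word_weight w"
  "word_weight (v @ w) = word_weight v + word_weight w"
  by (simp_all add: word_weight_def)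

definition weight_ball :: "('a, 'b) monoid_scheme \<Rightarrow> (letter \<Rightarrow> 'a) \<Rightarrow> nat \<Rightarrow> 'a set" where
  "weight_ball G e n = eval_word G e ` {w. word_weight w \<le> n}"

lemma length_le_word_weight: "length w \<le> word_weight w"
proof (induction w)
  case (Cons x w)
  then show ?case by (cases x) simp_all
qed simp

lemma word_weight_le_length: "word_weight w \<le> 3 * length w"
proof (induction w)
  case (Cons x w)
  then show ?case by (cases x) simp_all
qed simp

lemma finite_word_weight_le: "finite {w. word_weight w \<le> n}"
proof (rule finite_subset)
  show "{w. word_weight w \<le> n} \<subseteq> {w. set w \<subseteq> UNIV \<and> length w \<le> n}"
    using length_le_word_weight order_trans by blast
  show "finite {w. set w \<subseteq> (UNIV :: letter set) \<and> length w \<le> n}"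
    by (rule finite_lists_length_le) simp
qed

lemma finite_weight_ball: "finite (weight_ball G e n)"
  unfolding weight_ball_def using finite_word_weight_le by blast

text \<open>Every letter weighs at least 1, so a word of weight at most n has at most n letters.
  Padding it with \<open>None\<close> to length exactly n leaves five choices per place; this gives
  the initial rate \<open>ln 5\<close>.\<close>

lemma card_weight_ball_le: "card (weight_ball G e n) \<le> 5 ^ n"
proof -
  have "card (weight_ball G e n) \<le> card {w :: letter option list. length w = n}"
  proof (rule surj_card_le)
    have fin: "finite {w :: letter option list. set w \<subseteq> UNIV \<and> length w = n}"
      by (rule finite_lists_length_eq) simp
    then show "finite {w :: letter option list. length w = n}" by simp
    show "weight_ball G e n \<subseteq> (\<lambda>w. eval_word G e (map the (filter (\<lambda>x. x \<noteq> None) w))) ` {w. length w = n}"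
    proof
      fix g assume "g \<in> weight_ball G e n"
      then obtain w where w: "word_weight w \<le> n" "g = eval_word G e w" unfolding weight_ball_def by blast
      let ?v = "map Some w @ replicate (n - length w) None"
      have "length ?v = n" using w length_le_word_weight[of w] by simp
      moreover have "map the (filter (\<lambda>x. x \<noteq> None) ?v) = w" by (simp add: filter_map comp_def)
      ultimately show "g \<in> (\<lambda>w. eval_word G e (map the (filter (\<lambda>x. x \<noteq> None) w))) ` {w. length w = n}"
        using w by (intro image_eqI[of _ _ ?v]) simp_all
    qed
  qed
  also have "\<dots> = 5 ^ n"
  proof -
    have "card (UNIV :: letter option set) = 5" by (simp add: UNIV_option_conv UNIV_letter)
    then show ?thesis using card_lists_length_eq[of "UNIV :: letter option set" n] by simp
  qed
  finally show ?thesis .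
qed

abbreviation alternating :: "letter list \<Rightarrow> bool" where
  "alternating w \<equiv> successively (\<lambda>x y. (x = La) \<noteq> (y = La)) w"

text \<open>Equal neighbours cancel, and two different ones among b, c, d merge into the third,
  which weighs at most as much as both together.\<close>

lemma (in group) reduce_word:
  assumes e: "klein_marking G e"
  shows "\<exists>v. alternating v \<and> eval_word G e v = eval_word G e w \<and> word_weight v \<le> word_weight w"
proof (induction w)
  case (Cons x w)
  note e = klein_markingD[OF e]
  have closed: "eval_word G e v \<in> carrier G" for v using e(1) by (intro eval_word_closed) auto
  obtain v where v: "alternating v" "eval_word G e v = eval_word G e w" "word_weight v \<le> word_weight w"
    using Cons by blast
  show ?case
  proof (cases v)
    case Nil
    then show ?thesis using v by (intro exI[of _ "[x]"]) simp
  next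
    case (Cons y u)
    have u: "alternating u" using v(1) Cons by (cases u) simp_all
    have ev: "eval_word G e (x # w) = (e x \<otimes> e y) \<otimes> eval_word G e u"
      using v(2) Cons e(1) closed by (simp add: m_assoc flip: v(2))
    consider "(x = La) \<noteq> (y = La)" | "x = y" | "x \<noteq> La" "y \<noteq> La" "x \<noteq> y"
      by blast
    then show ?thesis
    proof cases
      case 1
      then show ?thesis using v Cons by (intro exI[of _ "x # v"]) (simp add: successively_Cons)
    next
      case 2
      then show ?thesis using v Cons u ev e(2) closed by (intro exI[of _ u]) simp
    next
      case 3
      have "\<exists>z. distinct [La, x, y, z] \<and> weight z \<le> weight x + weight y"
        using 3 by (cases x; cases y) (auto intro: exI[of _ Lb] exI[of _ Lc] exI[of _ Ld])
      then obtain z where z: "distinct [La, x, y, z]" "weight z \<le> weight x + weight y" by blast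
      then have "alternating (z # u)" using v Cons 3 by (auto simp: successively_Cons)
      moreover have "eval_word G e (z # u) = eval_word G e (x # w)" using ev e(3)[OF z(1)] by simp
      ultimately show ?thesis using v Cons z by (intro exI[of _ "z # u"]) simp
    qed
  qed
qed (intro exI[of _ "[]"], simp)

section \<open>The contracting wreath recursion\<close>

definition wreath_double :: "('a, 'b) monoid_scheme \<Rightarrow> (bool \<times> 'a \<times> 'a) monoid" where
  "wreath_double H = \<lparr>carrier = UNIV \<times> carrier H \<times> carrier H,
     monoid.mult = (\<lambda>(s, x0, x1) (t, y0, y1). (s \<noteq> t, x0 \<otimes>\<^bsub>H\<^esub> (if s then y1 else y0), x1 \<otimes>\<^bsub>H\<^esub> (if s then y0 else y1))),
     one = (False, \<one>\<^bsub>H\<^esub>, \<one>\<^bsub>H\<^esub>)\<rparr>"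

lemma wreath_double_simps [simp]:
  "carrier (wreath_double H) = UNIV \<times> carrier H \<times> carrier H"
  "(s, x0, x1) \<otimes>\<^bsub>wreath_double H\<^esub> (t, y0, y1) =
    (s \<noteq> t, x0 \<otimes>\<^bsub>H\<^esub> (if s then y1 else y0), x1 \<otimes>\<^bsub>H\<^esub> (if s then y0 else y1))"
  "\<one>\<^bsub>wreath_double H\<^esub> = (False, \<one>\<^bsub>H\<^esub>, \<one>\<^bsub>H\<^esub>)"
  by (simp_all add: wreath_double_def)

lemma group_wreath_double:
  assumes "group H"
  shows "group (wreath_double H)"
proof -
  interpret H: group H by fact
  show ?thesis
  proof (rule groupI)
    show "\<exists>y\<in>carrier (wreath_double H). y \<otimes>\<^bsub>wreath_double H\<^esub> x = \<one>\<^bsub>wreath_double H\<^esub>"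
      if x_in: "x \<in> carrier (wreath_double H)" for x
    proof -
      obtain s x0 x1 where x: "x = (s, x0, x1)" "x0 \<in> carrier H" "x1 \<in> carrier H" using x_in by auto
      then show ?thesis
        by (intro bexI[of _ "(s, if s then inv\<^bsub>H\<^esub> x1 else inv\<^bsub>H\<^esub> x0, if s then inv\<^bsub>H\<^esub> x0 else inv\<^bsub>H\<^esub> x1)"]) auto
    qed
  qed (auto simp: H.m_assoc)
qed

fun recursion_marking :: "('a, 'b) monoid_scheme \<Rightarrow> (letter \<Rightarrow> 'a) \<Rightarrow> letter \<Rightarrow> bool \<times> 'a \<times> 'a" where
  "recursion_marking H e La = (True, \<one>\<^bsub>H\<^esub>, \<one>\<^bsub>H\<^esub>)"
| "recursion_marking H e Lb = (False, e La, e Lc)"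
| "recursion_marking H e Lc = (False, e La, e Ld)"
| "recursion_marking H e Ld = (False, \<one>\<^bsub>H\<^esub>, e Lb)"

definition recursion_group :: "('a, 'b) monoid_scheme \<Rightarrow> (letter \<Rightarrow> 'a) \<Rightarrow> (bool \<times> 'a \<times> 'a) monoid" where
  "recursion_group H e =
     (wreath_double H)\<lparr>carrier := range (eval_word (wreath_double H) (recursion_marking H e))\<rparr>"

text \<open>The wreath recursion on unevaluated words, so that the weights of the coordinates can be
  compared letter by letter. The bit is the parity of the number of a.\<close>

fun split_word :: "letter list \<Rightarrow> bool \<times> letter list \<times> letter list" where
  "split_word [] = (False, [], [])"
| "split_word (La # w) = (case split_word w of (s, u, v) \<Rightarrow> (\<not> s, v, u))"
| "split_word (Lb # w) = (case split_word w of (s, u, v) \<Rightarrow> (s, La # u, Lc # v))"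
| "split_word (Lc # w) = (case split_word w of (s, u, v) \<Rightarrow> (s, La # u, Ld # v))"
| "split_word (Ld # w) = (case split_word w of (s, u, v) \<Rightarrow> (s, u, Lb # v))"

lemma eval_split_word:
  assumes H: "group H" and e: "range e \<subseteq> carrier H"
  shows "eval_word (wreath_double H) (recursion_marking H e) w =
    (case split_word w of (s, u, v) \<Rightarrow> (s, eval_word H e u, eval_word H e v))"
proof -
  interpret H: group H by fact
  show ?thesis
    using H.eval_word_closed[OF e] by (induction w rule: split_word.induct) (auto split: prod.splits)
qed

text \<open>A letter b, c, d adds 15, 14, 13 more to the left side than to the right side, while an
  a adds 15 to the right side only. In an alternating word the letters a pay for all others except
  possibly the first, whence the constant 15.\<close>

lemma split_word_contracts:
  assumes "alternating w" "split_word w = (s, u, v)"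
  shows "6 * (word_weight u + word_weight v) \<le> 5 * word_weight w + 15"
proof -
  have "6 * (word_weight u + word_weight v)
      \<le> 5 * word_weight w + (if w = [] \<or> hd w = La then 0 else 15)"
    using assms
  proof (induction w arbitrary: s u v)
    case (Cons x w)
    obtain s' u' v' where sw: "split_word w = (s', u', v')" by (cases "split_word w") auto
    have alt: "alternating w" "w = [] \<or> (x = La) \<noteq> (hd w = La)"
      using Cons.prems(1) by (cases w; simp)+
    show ?case using Cons.IH[OF alt(1) sw] alt(2) Cons.prems(2) sw by (cases x) (auto split: if_splits)
  qed simp
  then show ?thesis by (auto split: if_splits)
qed

section \<open>Decreasing the entropy\<close>

text \<open>The invariant of the iteration. The upper rate \<mu> is tracked explicitly, in weighted
  balls, because it has to shrink; of the lower rate only \<open>c > 1\<close> is kept.\<close>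

definition slow_group :: "('a, 'b) monoid_scheme \<Rightarrow> (letter \<Rightarrow> 'a) \<Rightarrow> real \<Rightarrow> bool" where
  "slow_group G e \<mu> \<longleftrightarrow>
     group G \<and> klein_marking G e \<and> carrier G = range (eval_word G e) \<and>
     polycyclic_in G (carrier G) \<and> (\<exists>M col. virtually_metabelian_map G M col) \<and>
     (\<exists>c>1. uniform_growth G c) \<and>
     (\<exists>K>0. \<forall>n. real (card (weight_ball G e n)) \<le> K * exp (\<mu> * real n))"

lemma exponential_uniform_growth_index_two:
  assumes "group G" "subgroup N G"
    "\<And>x y. x \<in> carrier G - N \<Longrightarrow> y \<in> carrier G - N \<Longrightarrow> x \<otimes>\<^bsub>G\<^esub> y \<in> N"
    "group H" "f \<in> hom (G\<lparr>carrier := N\<rparr>) H" "f ` N = carrier H"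
    and ug: "\<exists>c>1. uniform_growth H c"
  shows "\<exists>c>1. uniform_growth G c"
proof -
  obtain c where c: "c > 1" "uniform_growth H c" using ug by blast
  then have "root 3 c > 1" "root 3 c ^ 3 = c" by simp_all
  moreover from this have "uniform_growth G (root 3 c)"
    using c by (intro uniform_growth_index_two[OF assms(1-6)]) simp_all
  ultimately show ?thesis by blast
qed

lemma slow_group_iso:
  assumes slow: "slow_group G e \<mu>" and G': "group G'" and f: "f \<in> iso G G'"
  shows "slow_group G' (f \<circ> e) \<mu>"
proof -
  have G: "group G" and e: "klein_marking G e" and carr: "carrier G = range (eval_word G e)"
    and pc: "polycyclic_in G (carrier G)"
    and ug: "\<exists>c>1. uniform_growth G c"
    using slow unfolding slow_group_def by blast+
  obtain M col where vm: "virtually_metabelian_map G M col" using slow unfolding slow_group_def by blast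
  obtain K where K: "K > 0" "\<And>n. real (card (weight_ball G e n)) \<le> K * exp (\<mu> * real n)"
    using slow unfolding slow_group_def by blast
  interpret G: group G by fact
  interpret G': group G' by fact
  interpret f: group_hom G G' f using f G G' by (simp add: group_hom_def group_hom_axioms_def iso_def)
  have f_surj: "f ` carrier G = carrier G'" using f by (simp add: iso_def bij_betw_def)
  define h where "h = inv_into (carrier G) f"
  have h: "h \<in> iso G' G" using G.iso_set_sym[OF f] unfolding h_def .
  then have h_hom: "h \<in> hom G' G" and h_inj: "inj_on h (carrier G')" and h_surj: "h ` carrier G' = carrier G"
    by (auto simp: iso_def bij_betw_def)
  interpret h: group_hom G' G h using h_hom G G' by (simp add: group_hom_def group_hom_axioms_def)
  have closed: "eval_word G e w \<in> carrier G" for w using carr by blast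
  have ev: "eval_word G' (f \<circ> e) w = f (eval_word G e w)" for w
    using klein_markingD(1)[OF e] closed by (induction w) auto
  have "klein_marking G' (f \<circ> e)"
    unfolding klein_marking_def
    using klein_markingD[OF e] by (auto simp flip: f.hom_mult)
  moreover have "carrier G' = range (eval_word G' (f \<circ> e))"
    using f_surj carr by (simp add: ev image_image flip: f_surj)
  moreover have "polycyclic_in G' (carrier G')"
  proof -
    have "{g \<in> carrier G'. h g = \<one>\<^bsub>G\<^esub>} = {\<one>\<^bsub>G'\<^esub>}"
      using h_inj by (auto dest: inj_onD[of h "carrier G'" _ "\<one>\<^bsub>G'\<^esub>"])
    then have "polycyclic_in G' {g \<in> carrier G'. h g \<in> carrier G}"
      using h_hom by (intro polycyclic_in_vimage[OF G' G'.subgroup_self G _ _ pc]) (auto intro: polycyclic_in.trivial)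
    then show ?thesis by (simp cong: conj_cong)
  qed
  moreover have "\<exists>M col. virtually_metabelian_map G' M col"
    using virtually_metabelian_map_vimage[OF G' G h_hom h_inj vm] by blast
  \<comment> \<open>The index-two lemma is applied with the whole group as the subgroup, so its
    condition on the complement is vacuous. Only a rate above 1 has to survive.\<close>
  moreover have "\<exists>c>1. uniform_growth G' c"
    using h_hom h_surj
    by (intro exponential_uniform_growth_index_two[OF G' G'.subgroup_self _ G _ _ ug]) auto
  moreover have "real (card (weight_ball G' (f \<circ> e) n)) \<le> K * exp (\<mu> * real n)" for n
  proof -
    have "weight_ball G' (f \<circ> e) n = f ` weight_ball G e n"
      unfolding weight_ball_def by (simp add: image_image ev)
    then have "card (weight_ball G' (f \<circ> e) n) \<le> card (weight_ball G e n)"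
      using card_image_le[OF finite_weight_ball] by metis
    then show ?thesis using K(2)[of n] by linarith
  qed
  ultimately show ?thesis using G' K(1) unfolding slow_group_def by blast
qed

text \<open>A recursion step turns the element type \<open>'a\<close> into
  \<open>bool \<times> 'a \<times> 'a\<close>, so an induction on the number of steps needs a fixed
  type to return to. The groups are countable, being images of sets of words, hence have copies on
  the natural numbers.\<close>

lemma slow_group_nat:
  assumes slow: "slow_group G e \<mu>"
  shows "\<exists>(G' :: nat monoid) e'. slow_group G' e' \<mu>"
proof -
  have G: "group G" and carr: "carrier G = range (eval_word G e)"
    using slow unfolding slow_group_def by blast+
  interpret G: group G by fact
  define f where "f g = to_nat (SOME w. eval_word G e w = g)" for g
  have inj: "inj_on f (carrier G)"
  proof (rule inj_on_inverseI)
    fix g assume "g \<in> carrier G"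
    then show "eval_word G e (from_nat (f g)) = g"
      unfolding f_def carr by (auto intro: someI)
  qed
  define h where "h = inv_into (carrier G) f"
  have h: "h (f g) = g" if "g \<in> carrier G" for g unfolding h_def using inj that by simp
  define G' where "G' = \<lparr>carrier = f ` carrier G, monoid.mult = \<lambda>x y. f (h x \<otimes>\<^bsub>G\<^esub> h y), one = f \<one>\<^bsub>G\<^esub>\<rparr>"
  have hom: "f \<in> hom G G'" unfolding hom_def G'_def by (auto simp: h)
  have "group (G'\<lparr>carrier := f ` carrier G, one := f \<one>\<^bsub>G\<^esub>\<rparr>)"
    using G.hom_imp_img_group[OF hom] .
  then have "group G'" by (simp add: G'_def)
  moreover have "f \<in> iso G G'" using hom inj by (simp add: iso_def bij_betw_def G'_def)
  ultimately show ?thesis using slow_group_iso[OF slow] by blast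
qed

locale wreath_recursion = H: group H for H :: "('a, 'b) monoid_scheme" +
  fixes e :: "letter \<Rightarrow> 'a"
  assumes marking: "klein_marking H e" and carrier_H: "carrier H = range (eval_word H e)"
begin

abbreviation "W \<equiv> wreath_double H"
abbreviation "e' \<equiv> recursion_marking H e"
abbreviation "G \<equiv> recursion_group H e"

lemma e_closed [simp]: "e x \<in> carrier H"
  using klein_markingD(1)[OF marking] .

lemma eval_closed [simp]: "eval_word H e w \<in> carrier H"
  using carrier_H by blast

lemma marking_W: "klein_marking W e'"
proof (rule klein_markingI)
  show "e' x \<in> carrier W" for x by (cases x) simp_all
  show "e' x \<otimes>\<^bsub>W\<^esub> e' x = \<one>\<^bsub>W\<^esub>" for x by (cases x) (simp_all add: klein_markingD(2)[OF marking])
qed (simp_all add: klein_markingD(2,3)[OF marking])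

lemma subgroup_G: "subgroup (carrier G) W"
  using group.eval_word_subgroup[OF group_wreath_double[OF H.group_axioms], of e'] klein_markingD[OF marking_W]
  by (auto simp: recursion_group_def)

lemma G_simps [simp]: "monoid.mult G = monoid.mult W" "monoid.one G = monoid.one W" "eval_word G e' = eval_word W e'"
  by (auto simp: recursion_group_def eval_word_def)

lemma carrier_G: "carrier G = range (eval_word G e')"
  unfolding G_simps by (simp add: recursion_group_def)

sublocale G: group G
  using group.subgroup_imp_group[OF group_wreath_double[OF H.group_axioms] subgroup_G]
  by (simp add: recursion_group_def)

lemma marking_G: "klein_marking G e'"
proof -
  have "e' x \<in> carrier G" for x
  proof -
    have "e' x = eval_word G e' [x]" using klein_markingD(1)[OF marking_W, of x]
      by (cases x) (simp_all)
    then show ?thesis unfolding carrier_G by blast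
  qed
  then show ?thesis using marking_W unfolding klein_marking_def by auto
qed

lemma in_carrier_G: "(s, x, y) \<in> carrier G \<Longrightarrow> x \<in> carrier H \<and> y \<in> carrier H"
  using subgroup.subset[OF subgroup_G] by auto

lemma fst_mult: "g \<in> carrier G \<Longrightarrow> h \<in> carrier G \<Longrightarrow> fst (g \<otimes>\<^bsub>G\<^esub> h) = (fst g \<noteq> fst h)"
  by (cases g; cases h) simp

lemma fst_inv: "g \<in> carrier G \<Longrightarrow> fst (inv\<^bsub>G\<^esub> g) = fst g"
  using fst_mult[of g "inv\<^bsub>G\<^esub> g"] G.r_inv[of g] by auto

definition "stab = {g \<in> carrier G. \<not> fst g}"

lemma subgroup_stab: "subgroup stab G"
proof (rule G.subgroupI)
  have "\<one>\<^bsub>G\<^esub> \<in> stab" unfolding stab_def using G.one_closed by simp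
  then show "stab \<noteq> {}" by blast
qed (auto simp: stab_def fst_mult fst_inv simp del: G_simps)

lemma left_hom: "fst \<circ> snd \<in> hom (G\<lparr>carrier := stab\<rparr>) H"
  and right_hom: "snd \<circ> snd \<in> hom (G\<lparr>carrier := stab\<rparr>) H"
  unfolding hom_def stab_def using in_carrier_G by auto

sublocale stab: group "G\<lparr>carrier := stab\<rparr>"
  using G.subgroup_imp_group[OF subgroup_stab] .

sublocale left: group_hom "G\<lparr>carrier := stab\<rparr>" H "fst \<circ> snd"
  using left_hom by unfold_locales

sublocale right: group_hom "G\<lparr>carrier := stab\<rparr>" H "snd \<circ> snd"
  using right_hom by unfold_locales

text \<open>The series passes through \<open>R\<close>, where the left coordinate is trivial and
  which embeds into \<open>H\<close> by the right one; through \<open>stab\<close>, which maps to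
  \<open>H\<close> by the left coordinate with kernel \<open>R\<close>; and ends with the powers of
  a.\<close>

lemma polycyclic_G:
  assumes "polycyclic_in H (carrier H)"
  shows "polycyclic_in G (carrier G)"
proof -
  define R where "R = {g \<in> stab. (fst \<circ> snd) g = \<one>\<^bsub>H\<^esub>}"
  have "subgroup R (G\<lparr>carrier := stab\<rparr>)"
    using left.subgroup_kernel unfolding kernel_def R_def by simp
  then have R: "subgroup R G" using G.incl_subgroup[OF subgroup_stab] by blast
  have "R \<subseteq> stab" unfolding R_def by blast
  then have R_hom: "snd \<circ> snd \<in> hom (G\<lparr>carrier := R\<rparr>) H"
    using right_hom unfolding hom_def by auto
  have "{g \<in> R. (snd \<circ> snd) g = \<one>\<^bsub>H\<^esub>} = {\<one>\<^bsub>G\<^esub>}"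
    using subgroup.one_closed[OF R] by (auto simp: R_def stab_def)
  then have "polycyclic_in G {g \<in> R. (snd \<circ> snd) g \<in> carrier H}"
    using polycyclic_in.trivial[of G]
    by (intro polycyclic_in_vimage[OF G.group_axioms R H.group_axioms R_hom _ assms]) simp
  moreover have "{g \<in> R. (snd \<circ> snd) g \<in> carrier H} = R"
    using in_carrier_G by (auto simp: R_def stab_def)
  ultimately have "polycyclic_in G {g \<in> stab. (fst \<circ> snd) g \<in> carrier H}"
    unfolding R_def
    by (intro polycyclic_in_vimage[OF G.group_axioms subgroup_stab H.group_axioms left_hom _ assms]) simp
  moreover have "{g \<in> stab. (fst \<circ> snd) g \<in> carrier H} = stab"
    using in_carrier_G by (auto simp: stab_def)
  ultimately have stab: "polycyclic_in G stab" by simp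
  have a: "e' La \<in> carrier G" "e' La \<otimes>\<^bsub>G\<^esub> e' La = \<one>\<^bsub>G\<^esub>" using klein_markingD[OF marking_G] by blast+
  show ?thesis
  proof (rule polycyclic_in.cyclic_extension[OF stab G.subgroup_self])
    show "stab \<subseteq> carrier G" unfolding stab_def by blast
    show "e' La \<in> carrier G" by fact
    show "g \<otimes>\<^bsub>G\<^esub> m \<otimes>\<^bsub>G\<^esub> inv\<^bsub>G\<^esub> g \<in> stab" if "g \<in> carrier G" "m \<in> stab" for g m
      using that by (simp add: stab_def fst_mult fst_inv del: G_simps)
    show "\<exists>k::int. \<exists>m\<in>stab. g = e' La [^]\<^bsub>G\<^esub> k \<otimes>\<^bsub>G\<^esub> m" if g: "g \<in> carrier G" for g
    proof (cases "fst g")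
      case True
      have "e' La \<otimes>\<^bsub>G\<^esub> g \<in> stab"
        using True g a G.m_closed[OF a(1) g] unfolding stab_def by (simp add: fst_mult del: G_simps)
      moreover have "e' La \<otimes>\<^bsub>G\<^esub> (e' La \<otimes>\<^bsub>G\<^esub> g) = g"
        using a g by (simp del: G_simps recursion_marking.simps flip: G.m_assoc)
      then have "g = e' La [^]\<^bsub>G\<^esub> (1 :: int) \<otimes>\<^bsub>G\<^esub> (e' La \<otimes>\<^bsub>G\<^esub> g)"
        using a G.int_pow_1[OF a(1)] by simp
      ultimately show ?thesis by blast
    next
      case False
      then have "g \<in> stab" "g = e' La [^]\<^bsub>G\<^esub> (0 :: int) \<otimes>\<^bsub>G\<^esub> g"
        using g by (simp_all add: stab_def del: G_simps)
      then show ?thesis by blast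
    qed
  qed
qed

text \<open>Products in \<open>stab\<close> are coordinatewise, so commutators of pairs from
  \<open>M\<close> commute in each coordinate. A colour records the swap bit and the old colours of
  both coordinates.\<close>

lemma virtually_metabelian_G:
  assumes "virtually_metabelian_map H M col"
  shows "\<exists>M col. virtually_metabelian_map G M col"
proof -
  have sub: "subgroup M H" and fin: "finite (col ` carrier H)"
    and col: "\<And>x y. x \<in> carrier H \<Longrightarrow> y \<in> carrier H \<Longrightarrow> col x = col y \<Longrightarrow> x \<otimes>\<^bsub>H\<^esub> inv\<^bsub>H\<^esub> y \<in> M"
    and comm: "\<And>x y. x \<in> derived_set H M \<Longrightarrow> y \<in> derived_set H M \<Longrightarrow> x \<otimes>\<^bsub>H\<^esub> y = y \<otimes>\<^bsub>H\<^esub> x"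
    using assms unfolding virtually_metabelian_map_def by blast+
  interpret M: subgroup M H by fact
  define P where "P = {g \<in> stab. (fst \<circ> snd) g \<in> M \<and> (snd \<circ> snd) g \<in> M}"
  define colP where "colP = (\<lambda>(s :: bool, x, y). to_nat (s, col x, col y))"
  note stab_mult = subgroup.m_closed[OF subgroup_stab] and stab_inv = subgroup.m_inv_closed[OF subgroup_stab]
  have left_mult: "(fst \<circ> snd) (g \<otimes>\<^bsub>G\<^esub> h) = (fst \<circ> snd) g \<otimes>\<^bsub>H\<^esub> (fst \<circ> snd) h"
    and right_mult: "(snd \<circ> snd) (g \<otimes>\<^bsub>G\<^esub> h) = (snd \<circ> snd) g \<otimes>\<^bsub>H\<^esub> (snd \<circ> snd) h"
    if "g \<in> stab" "h \<in> stab" for g h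
    using that left.hom_mult[of g h] right.hom_mult[of g h] by simp_all
  have left_inv: "(fst \<circ> snd) (inv\<^bsub>G\<^esub> g) = inv\<^bsub>H\<^esub> (fst \<circ> snd) g"
    and right_inv: "(snd \<circ> snd) (inv\<^bsub>G\<^esub> g) = inv\<^bsub>H\<^esub> (snd \<circ> snd) g"
    if "g \<in> stab" for g
    using that left.hom_inv[of g] right.hom_inv[of g] G.m_inv_consistent[OF subgroup_stab, of g] by simp_all
  have der: "g \<in> stab \<and> (fst \<circ> snd) g \<in> derived_set H M \<and> (snd \<circ> snd) g \<in> derived_set H M"
    if g_der: "g \<in> derived_set G P" for g
  proof -
    obtain x y where xy: "x \<in> P" "y \<in> P" "g = x \<otimes>\<^bsub>G\<^esub> y \<otimes>\<^bsub>G\<^esub> inv\<^bsub>G\<^esub> x \<otimes>\<^bsub>G\<^esub> inv\<^bsub>G\<^esub> y"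
      using g_der by blast
    then have st: "x \<in> stab" "y \<in> stab" "(fst \<circ> snd) x \<in> M" "(fst \<circ> snd) y \<in> M" "(snd \<circ> snd) x \<in> M" "(snd \<circ> snd) y \<in> M"
      unfolding P_def by blast+
    have st': "inv\<^bsub>G\<^esub> x \<in> stab" "inv\<^bsub>G\<^esub> y \<in> stab" "x \<otimes>\<^bsub>G\<^esub> y \<in> stab" "x \<otimes>\<^bsub>G\<^esub> y \<otimes>\<^bsub>G\<^esub> inv\<^bsub>G\<^esub> x \<in> stab"
      by (intro stab_inv stab_mult st)+
    have "g \<in> stab" unfolding xy by (intro stab_mult st')
    moreover have "(fst \<circ> snd) g \<in> derived_set H M"
      unfolding xy(3) left_mult[OF st'(4,2)] left_mult[OF st'(3,1)] left_mult[OF st(1,2)] left_inv[OF st(1)] left_inv[OF st(2)]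
      using st by blast
    moreover have "(snd \<circ> snd) g \<in> derived_set H M"
      unfolding xy(3) right_mult[OF st'(4,2)] right_mult[OF st'(3,1)] right_mult[OF st(1,2)] right_inv[OF st(1)] right_inv[OF st(2)]
      using st by blast
    ultimately show ?thesis by blast
  qed
  have "virtually_metabelian_map G P colP"
    unfolding virtually_metabelian_map_def
  proof (intro conjI ballI impI)
    show "subgroup P G"
    proof (rule G.subgroupI)
      show "P \<subseteq> carrier G" unfolding P_def stab_def by blast
      have "\<one>\<^bsub>G\<^esub> \<in> P" unfolding P_def stab_def using G.one_closed by simp
      then show "P \<noteq> {}" by blast
      show "inv\<^bsub>G\<^esub> g \<in> P" if "g \<in> P" for g
        using that stab_inv[of g] left_inv[of g] right_inv[of g] unfolding P_def by auto
      show "g \<otimes>\<^bsub>G\<^esub> h \<in> P" if "g \<in> P" "h \<in> P" for g h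
        using that stab_mult[of g h] left_mult[of g h] right_mult[of g h] unfolding P_def by auto
    qed
    have "colP ` carrier G \<subseteq> to_nat ` ((UNIV :: bool set) \<times> col ` carrier H \<times> col ` carrier H)"
    proof
      fix i assume "i \<in> colP ` carrier G"
      then obtain s x y where g: "(s, x, y) \<in> carrier G" "i = to_nat (s, col x, col y)"
        unfolding colP_def by force
      then show "i \<in> to_nat ` ((UNIV :: bool set) \<times> col ` carrier H \<times> col ` carrier H)"
        using in_carrier_G[OF g(1)] unfolding g(2) by (intro imageI) auto
    qed
    then show "finite (colP ` carrier G)" using fin by (meson finite_SigmaI finite_code finite_imageI finite_subset finite)
    show "g \<otimes>\<^bsub>G\<^esub> inv\<^bsub>G\<^esub> h \<in> P" if gh: "g \<in> carrier G" "h \<in> carrier G" "colP g = colP h" for g h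
    proof -
      obtain s x0 x1 t y0 y1 where g: "g = (s, x0, x1)" and h: "h = (t, y0, y1)" by (cases g, cases h) blast
      have st: "t = s" "col x0 = col y0" "col x1 = col y1" using gh(3) unfolding g h colP_def by auto
      have xy: "x0 \<in> carrier H" "x1 \<in> carrier H" "y0 \<in> carrier H" "y1 \<in> carrier H"
        using gh in_carrier_G unfolding g h by blast+
      \<comment> \<open>Equal swap bits cancel in the product of g with the inverse of h, which is
        therefore k. This is checked by multiplying by h, without computing the inverse.\<close>
      define k where "k = (False, x0 \<otimes>\<^bsub>H\<^esub> inv\<^bsub>H\<^esub> y0, x1 \<otimes>\<^bsub>H\<^esub> inv\<^bsub>H\<^esub> y1)"
      have "k \<otimes>\<^bsub>W\<^esub> h = g" using xy unfolding k_def g h st by (simp add: H.m_assoc)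
      moreover have k: "k \<in> carrier W" using xy unfolding k_def by simp
      moreover have "g \<otimes>\<^bsub>G\<^esub> inv\<^bsub>G\<^esub> h \<otimes>\<^bsub>W\<^esub> h = g"
        using gh by (simp add: G.m_assoc flip: G_simps)
      moreover have gh': "g \<otimes>\<^bsub>G\<^esub> inv\<^bsub>G\<^esub> h \<in> carrier G" using gh by (simp del: G_simps)
      ultimately have "g \<otimes>\<^bsub>G\<^esub> inv\<^bsub>G\<^esub> h = k"
        using group.right_cancel[OF group_wreath_double[OF H.group_axioms] _ _ k, of h "g \<otimes>\<^bsub>G\<^esub> inv\<^bsub>G\<^esub> h"]
          gh(2) subsetD[OF subgroup.subset[OF subgroup_G]] by simp
      then show ?thesis using gh' col[OF xy(1,3) st(2)] col[OF xy(2,4) st(3)]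
        unfolding P_def stab_def k_def by simp
    qed
    show "g \<otimes>\<^bsub>G\<^esub> h = h \<otimes>\<^bsub>G\<^esub> g" if "g \<in> derived_set G P" "h \<in> derived_set G P" for g h
    proof -
      note g = der[OF that(1)] and h = der[OF that(2)]
      have gs: "g \<in> stab" and hs: "h \<in> stab" using g h by blast+
      have "fst (g \<otimes>\<^bsub>G\<^esub> h) = fst (h \<otimes>\<^bsub>G\<^esub> g)"
        using gs hs unfolding stab_def by (simp add: fst_mult del: G_simps)
      moreover have "(fst \<circ> snd) (g \<otimes>\<^bsub>G\<^esub> h) = (fst \<circ> snd) (h \<otimes>\<^bsub>G\<^esub> g)"
        unfolding left_mult[OF gs hs] left_mult[OF hs gs] by (rule comm) (use g h in blast)+
      moreover have "(snd \<circ> snd) (g \<otimes>\<^bsub>G\<^esub> h) = (snd \<circ> snd) (h \<otimes>\<^bsub>G\<^esub> g)"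
        unfolding right_mult[OF gs hs] right_mult[OF hs gs] by (rule comm) (use g h in blast)+
      ultimately show ?thesis unfolding prod_eq_iff comp_apply by blast
    qed
  qed
  then show ?thesis by blast
qed

lemma uniform_growth_G:
  assumes "\<exists>c>1. uniform_growth H c"
  shows "\<exists>c>1. uniform_growth G c"
proof (rule exponential_uniform_growth_index_two[OF G.group_axioms subgroup_stab _ H.group_axioms right_hom _ assms])
  show "g \<otimes>\<^bsub>G\<^esub> h \<in> stab" if "g \<in> carrier G - stab" "h \<in> carrier G - stab" for g h
    using that unfolding stab_def by (auto simp: fst_mult simp del: G_simps)
  \<comment> \<open>In the right coordinate d, b, c become b, c, d, and a b a = (c, a) supplies a.
    The left coordinate u is whatever results.\<close>
  have ex: "\<exists>v u. eval_word W e' v = (False, u, eval_word H e w)" for w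
  proof (induction w)
    case Nil
    show ?case by (intro exI[of _ "[]"]) simp
  next
    case (Cons x w)
    then obtain v u where v: "eval_word W e' v = (False, u, eval_word H e w)" by blast
    have "u \<in> carrier H" using v in_carrier_G[of False u] carrier_G by (metis G_simps(3) rangeI)
    then show ?case
    proof (cases x)
      case La
      then show ?thesis using v \<open>u \<in> carrier H\<close> by (intro exI[of _ "La # Lb # La # v"]) simp
    next
      case Lb
      then show ?thesis using v by (intro exI[of _ "Ld # v"]) simp
    next
      case Lc
      then show ?thesis using v by (intro exI[of _ "Lb # v"]) simp
    next
      case Ld
      then show ?thesis using v by (intro exI[of _ "Lc # v"]) simp
    qed
  qed
  have "eval_word H e w \<in> (snd \<circ> snd) ` stab" for w
  proof -
    obtain v u where v: "eval_word W e' v = (False, u, eval_word H e w)" using ex by blast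
    have "eval_word W e' v \<in> carrier G" unfolding carrier_G by simp
    then have "eval_word W e' v \<in> stab" using v unfolding stab_def by simp
    then show ?thesis using v by (intro image_eqI[of _ _ "eval_word W e' v"]) simp_all
  qed
  then have "carrier H \<subseteq> (snd \<circ> snd) ` stab" unfolding carrier_H by blast
  moreover have "(snd \<circ> snd) ` stab \<subseteq> carrier H" using in_carrier_G by (auto simp: stab_def)
  ultimately show "(snd \<circ> snd) ` stab = carrier H" by blast
qed

text \<open>The word is reduced before it is split, since the contraction estimate concerns
  alternating words. The second coordinate is granted all the weight that the first one
  leaves.\<close>

lemma weight_ball_G:
  "weight_ball G e' n \<subseteq>
    UNIV \<times> (\<Union>i\<le>(5 * n + 15) div 6. weight_ball H e i \<times> weight_ball H e ((5 * n + 15) div 6 - i))"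
proof
  fix g assume "g \<in> weight_ball G e' n"
  then obtain w where w: "word_weight w \<le> n" "g = eval_word G e' w" unfolding weight_ball_def by blast
  obtain v where v: "alternating v" "eval_word G e' v = g" "word_weight v \<le> n"
    using G.reduce_word[OF marking_G, of w] w by auto
  obtain s x y where split: "split_word v = (s, x, y)" by (cases "split_word v") auto
  have g: "g = (s, eval_word H e x, eval_word H e y)"
    using v(2) split eval_split_word[OF H.group_axioms, of e v] by (simp add: image_subset_iff)
  have "6 * (word_weight x + word_weight y) \<le> 5 * n + 15"
    using split_word_contracts[OF v(1) split] v(3) by linarith
  then have "word_weight x + word_weight y \<le> (5 * n + 15) div 6" by (simp add: less_eq_div_iff_mult_less_eq)
  then show "g \<in> UNIV \<times> (\<Union>i\<le>(5 * n + 15) div 6. weight_ball H e i \<times> weight_ball H e ((5 * n + 15) div 6 - i))"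
    unfolding g weight_ball_def by (auto intro!: bexI[of _ "word_weight x"] imageI)
qed

text \<open>For every i the product of the two balls has at most K^2 exp(\<mu> m) elements, whatever
  i is. The number of values of i gives a factor m + 1, and the swap bit a factor 2.\<close>

lemma growth_G:
  assumes K: "K > 0" and \<mu>: "\<mu> > 0"
    and bound: "\<And>n. real (card (weight_ball H e n)) \<le> K * exp (\<mu> * real n)"
  shows "\<exists>K>0. \<forall>n. real (card (weight_ball G e' n)) \<le> K * exp (7 / 8 * \<mu> * real n)"
proof (intro exI[of _ "2 * (1 + 20 / \<mu>) * K ^ 2 * exp (21 / 8 * \<mu>)"] conjI allI)
  show "2 * (1 + 20 / \<mu>) * K ^ 2 * exp (21 / 8 * \<mu>) > 0" using K \<mu> by (simp add: add_pos_pos)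
  fix n :: nat
  define m where "m = (5 * n + 15) div 6"
  have m: "real m \<le> (5 * real n + 15) / 6"
  proof -
    have "6 * m \<le> 5 * n + 15" unfolding m_def by simp
    then have "real (6 * m) \<le> real (5 * n + 15)" by (simp only: of_nat_le_iff)
    then show ?thesis by simp
  qed
  \<comment> \<open>The factor m + 1 is absorbed by exp(\<mu> m / 20), which raises the exponent to
    21/20 \<mu> m. With m at most (5n + 15)/6 this becomes 7/8 \<mu> n + 21/8 \<mu>. Any fraction
    below 1/5 in place of 1/20 would leave a factor below 1.\<close>
  have "(real m + 1) * exp (\<mu> * real m) \<le> ((1 + 20 / \<mu>) * exp (\<mu> / 20 * real m)) * exp (\<mu> * real m)"
  proof (intro mult_right_mono)
    have "(1 + 20 / \<mu>) * (1 + \<mu> / 20 * real m) \<le> (1 + 20 / \<mu>) * exp (\<mu> / 20 * real m)"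
      using \<mu> exp_ge_add_one_self[of "\<mu> / 20 * real m"] by (intro mult_left_mono) auto
    moreover have "(1 + 20 / \<mu>) * (1 + \<mu> / 20 * real m) = (real m + 1) + (20 / \<mu> + \<mu> / 20 * real m)"
      using \<mu> by (simp add: distrib_right distrib_left)
    moreover have "20 / \<mu> + \<mu> / 20 * real m \<ge> 0" using \<mu> by simp
    ultimately show "real m + 1 \<le> (1 + 20 / \<mu>) * exp (\<mu> / 20 * real m)" by linarith
  qed simp
  also have "\<dots> = (1 + 20 / \<mu>) * exp (21 / 20 * \<mu> * real m)" by (simp flip: exp_add)
  also have "\<dots> \<le> (1 + 20 / \<mu>) * exp (21 / 20 * \<mu> * ((5 * real n + 15) / 6))"
    using \<mu> m by (intro mult_left_mono) (auto simp: mult_left_mono)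
  also have "21 / 20 * \<mu> * ((5 * real n + 15) / 6) = 21 / 8 * \<mu> + 7 / 8 * \<mu> * real n"
    by (simp add: field_simps)
  finally have inner: "(real m + 1) * exp (\<mu> * real m) \<le> (1 + 20 / \<mu>) * exp (21 / 8 * \<mu> + 7 / 8 * \<mu> * real n)" .
  let ?U = "\<Union>i\<le>m. weight_ball H e i \<times> weight_ball H e (m - i)"
  have "card (weight_ball G e' n) \<le> card ((UNIV :: bool set) \<times> ?U)"
    using weight_ball_G[of n] unfolding m_def[symmetric] by (intro card_mono) (auto simp: finite_weight_ball)
  also have "\<dots> = 2 * card ?U" by (simp add: card_cartesian_product)
  also have "card ?U \<le> (\<Sum>i\<le>m. card (weight_ball H e i \<times> weight_ball H e (m - i)))"
    by (rule card_UN_le) simp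
  finally have "card (weight_ball G e' n) \<le> 2 * (\<Sum>i\<le>m. card (weight_ball H e i) * card (weight_ball H e (m - i)))"
    by (simp add: card_cartesian_product)
  then have "real (card (weight_ball G e' n)) \<le> real (2 * (\<Sum>i\<le>m. card (weight_ball H e i) * card (weight_ball H e (m - i))))"
    by (simp only: of_nat_le_iff)
  also have "\<dots> = 2 * (\<Sum>i\<le>m. real (card (weight_ball H e i)) * real (card (weight_ball H e (m - i))))"
    by simp
  also have "\<dots> \<le> 2 * (\<Sum>i\<le>m. (K * exp (\<mu> * real i)) * (K * exp (\<mu> * real (m - i))))"
    using bound K by (intro mult_left_mono sum_mono mult_mono) (auto intro: mult_nonneg_nonneg simp del: of_nat_diff)
  also have "(\<Sum>i\<le>m. (K * exp (\<mu> * real i)) * (K * exp (\<mu> * real (m - i)))) = (\<Sum>i\<le>m. K ^ 2 * exp (\<mu> * real m))"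
  proof (rule sum.cong[OF refl])
    fix i assume "i \<in> {..m}"
    then have "\<mu> * real m = \<mu> * real i + \<mu> * real (m - i)" by (simp add: of_nat_diff algebra_simps)
    then show "(K * exp (\<mu> * real i)) * (K * exp (\<mu> * real (m - i))) = K ^ 2 * exp (\<mu> * real m)"
      by (simp add: exp_add power2_eq_square)
  qed
  also have "\<dots> = K ^ 2 * ((real m + 1) * exp (\<mu> * real m))" by simp
  also have "2 * (K ^ 2 * ((real m + 1) * exp (\<mu> * real m)))
      \<le> 2 * (K ^ 2 * ((1 + 20 / \<mu>) * exp (21 / 8 * \<mu> + 7 / 8 * \<mu> * real n)))"
    using inner by (intro mult_left_mono) simp_all
  finally show "real (card (weight_ball G e' n)) \<le> 2 * (1 + 20 / \<mu>) * K ^ 2 * exp (21 / 8 * \<mu>) * exp (7 / 8 * \<mu> * real n)"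
    by (simp only: exp_add mult_ac)
qed

end

lemma slow_group_recursion:
  assumes slow: "slow_group H e \<mu>" and \<mu>: "\<mu> > 0"
  shows "slow_group (recursion_group H e) (recursion_marking H e) (7 / 8 * \<mu>)"
proof -
  interpret wreath_recursion H e
    using slow unfolding slow_group_def wreath_recursion_def wreath_recursion_axioms_def by blast
  show ?thesis
    using slow G.group_axioms marking_G carrier_G polycyclic_G virtually_metabelian_G uniform_growth_G growth_G[OF _ \<mu>]
    unfolding slow_group_def by blast
qed

section \<open>The initial group\<close>

definition bijections :: "('x \<Rightarrow> 'x) monoid" where
  "bijections = \<lparr>carrier = {f. bij f}, monoid.mult = (\<circ>), one = id\<rparr>"

lemma bijections_simps [simp]:
  "carrier bijections = {f. bij f}" "f \<otimes>\<^bsub>bijections\<^esub> g = f \<circ> g" "\<one>\<^bsub>bijections\<^esub> = id"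
  by (simp_all add: bijections_def)

lemma group_bijections: "group bijections"
proof (rule groupI)
  show "\<exists>g\<in>carrier bijections. g \<otimes>\<^bsub>bijections\<^esub> f = \<one>\<^bsub>bijections\<^esub>" if "f \<in> carrier bijections" for f :: "'x \<Rightarrow> 'x"
    using that by (intro bexI[of _ "inv_into UNIV f"]) (auto simp: bij_imp_bij_inv bij_is_inj)
qed (auto simp: bij_comp comp_assoc)

definition nonzero_reals :: "real monoid" where
  "nonzero_reals = \<lparr>carrier = {x. x \<noteq> 0}, monoid.mult = (*), one = 1\<rparr>"

lemma nonzero_reals_simps [simp]:
  "carrier nonzero_reals = {x. x \<noteq> 0}" "x \<otimes>\<^bsub>nonzero_reals\<^esub> y = x * y" "\<one>\<^bsub>nonzero_reals\<^esub> = 1"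
  by (simp_all add: nonzero_reals_def)

interpretation nonzero_reals: comm_group nonzero_reals
proof (rule comm_groupI)
  show "\<exists>y\<in>carrier nonzero_reals. y \<otimes>\<^bsub>nonzero_reals\<^esub> x = \<one>\<^bsub>nonzero_reals\<^esub>" if "x \<in> carrier nonzero_reals" for x
    using that by (intro bexI[of _ "inverse x"]) auto
qed auto

lemma nonzero_reals_inv: "x \<noteq> 0 \<Longrightarrow> inv\<^bsub>nonzero_reals\<^esub> x = inverse x"
  by (rule nonzero_reals.inv_equality) auto

lemma nonzero_reals_int_pow: "x \<noteq> 0 \<Longrightarrow> x [^]\<^bsub>nonzero_reals\<^esub> (k :: int) = x powi k"
proof -
  assume x: "x \<noteq> 0"
  have nat: "x [^]\<^bsub>nonzero_reals\<^esub> n = x ^ n" for n :: nat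
    by (induction n) (simp_all add: nat_pow_def mult.commute)
  show ?thesis
    using x by (auto simp: int_pow_def2 nat power_int_def nonzero_reals_inv power_inverse)
qed

text \<open>An eigenvalue of \<open>(p, q) \<mapsto> (3 p + q, - p)\<close>, the composition of b and a below; \<open>1 / \<lambda>\<close> is the other one.\<close>

definition lam :: real where "lam = (3 + sqrt 5) / 2"

lemma lam: "lam ^ 2 = 3 * lam - 1" "lam \<ge> 2" "1 / lam = 3 - lam"
proof -
  show sq: "lam ^ 2 = 3 * lam - 1" by (simp add: lam_def power2_eq_square field_simps)
  have "sqrt 1 \<le> sqrt 5" by (rule real_sqrt_le_mono) simp
  then show "lam \<ge> 2" by (simp add: lam_def)
  then show "1 / lam = 3 - lam" using sq by (simp add: field_simps power2_eq_square)
qed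

text \<open>The map (p, q) to (3 p + q, - p) multiplies the linear forms p \<open>lam\<close> + q
  and p + q \<open>lam\<close> by \<open>lam\<close> and 1 / \<open>lam\<close>; these are the two
  eigenvalue equations.\<close>

lemma lam_mult:
  "lam * (p * lam + q) = (3 * p + q) * lam - p" "1 / lam * (p + q * lam) = 3 * p + q - p * lam"
proof -
  have sq: "lam * lam = 3 * lam - 1" using lam(1) by (simp add: power2_eq_square)
  have "lam * (p * lam + q) = p * (lam * lam) + q * lam"
    "(3 - lam) * (p + q * lam) = (3 - lam) * p + q * (3 * lam - lam * lam)"
    by (simp_all add: algebra_simps)
  then show "lam * (p * lam + q) = (3 * p + q) * lam - p" "1 / lam * (p + q * lam) = 3 * p + q - p * lam"
    unfolding sq lam(3) by (simp_all add: algebra_simps)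
qed

definition dilations :: "real set" where
  "dilations = {s * lam powi k | s k. s \<in> {1, -1}}"

lemma dilationsI: "lam powi k \<in> dilations" "- (lam powi k) \<in> dilations"
  unfolding dilations_def by force+

lemma one_in_dilations: "1 \<in> dilations" and minus_one_in_dilations: "-1 \<in> dilations"
  and lam_in_dilations: "lam \<in> dilations"
  using dilationsI[of 0] dilationsI[of 1] by simp_all

lemma dilations_nonzero: "\<alpha> \<in> dilations \<Longrightarrow> \<alpha> \<noteq> 0"
  using lam(2) unfolding dilations_def by auto

lemma dilations_mult: "\<alpha> \<in> dilations \<Longrightarrow> \<beta> \<in> dilations \<Longrightarrow> \<alpha> * \<beta> \<in> dilations"
proof -
  assume "\<alpha> \<in> dilations" "\<beta> \<in> dilations"
  then obtain s k t l where st: "\<alpha> = s * lam powi k" "\<beta> = t * lam powi l" "s \<in> {1, -1}" "t \<in> {1, -1}"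
    unfolding dilations_def by blast
  then have "\<alpha> * \<beta> = (s * t) * lam powi (k + l)" using lam(2) by (simp add: power_int_add)
  moreover have "s * t \<in> {1, -1}" using st by auto
  ultimately show ?thesis unfolding dilations_def by blast
qed

lemma dilations_inverse: "\<alpha> \<in> dilations \<Longrightarrow> 1 / \<alpha> \<in> dilations"
proof -
  assume "\<alpha> \<in> dilations"
  then obtain s k where s: "\<alpha> = s * lam powi k" "s \<in> {1, -1}"
    unfolding dilations_def by blast
  then have "1 / \<alpha> = s * lam powi (- k)" by (auto simp: power_int_minus divide_inverse)
  then show ?thesis using s(2) unfolding dilations_def by blast
qed

text \<open>Since \<open>lam\<close> is at least 2, its powers skip the intervals between 1/2 and 1
  and between 1 and 2. Thanks to this gap a single generator or its inverse already contracts enough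
  for ping-pong.\<close>

lemma dilations_bounds:
  assumes "\<alpha> \<in> dilations"
  shows "\<bar>\<alpha>\<bar> = 1 \<or> \<bar>\<alpha>\<bar> \<le> 1 / 2 \<or> \<bar>\<alpha>\<bar> \<ge> 2"
proof -
  obtain s k where s: "\<alpha> = s * lam powi k" "s \<in> {1, -1}"
    using assms unfolding dilations_def by blast
  have abs: "\<bar>\<alpha>\<bar> = lam powi k" using s lam(2) by (auto simp: abs_mult)
  have pow: "2 \<le> lam powi j" if "j \<ge> 1" for j :: int
    using power_int_increasing[of 1 j lam] that lam(2) by simp
  consider "k = 0" | "k \<ge> 1" | "- k \<ge> 1" by linarith
  then show ?thesis
  proof cases
    case 3
    then have "2 \<le> inverse (lam powi k)" using pow[of "- k"] by (simp add: power_int_minus)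
    then have "lam powi k \<le> 1 / 2" using lam(2) by (simp add: field_simps)
    then show ?thesis using abs by simp
  qed (use abs pow in auto)
qed

lemma polycyclic_dilations: "polycyclic_in nonzero_reals dilations"
proof -
  have "polycyclic_in nonzero_reals {1, -1}"
  proof (rule polycyclic_in.cyclic_extension[OF polycyclic_in.trivial])
    show "subgroup {1, -1} nonzero_reals"
      by (rule nonzero_reals.subgroupI) (auto simp: nonzero_reals_inv)
    show "- 1 \<in> {1, - 1 :: real}" by simp
    show "\<exists>k::int. \<exists>m\<in>{\<one>\<^bsub>nonzero_reals\<^esub>}. g = - 1 [^]\<^bsub>nonzero_reals\<^esub> k \<otimes>\<^bsub>nonzero_reals\<^esub> m"
      if "g \<in> {1, -1}" for g
      using that by (auto simp: nonzero_reals_int_pow intro: exI[of _ 0] exI[of _ 1])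
  qed (auto simp: nonzero_reals_inv)
  then show ?thesis
  proof (rule polycyclic_in.cyclic_extension)
    show "subgroup dilations nonzero_reals"
    proof (rule nonzero_reals.subgroupI)
      show "dilations \<subseteq> carrier nonzero_reals" using dilations_nonzero by auto
      show "dilations \<noteq> {}" using one_in_dilations by blast
      show "inv\<^bsub>nonzero_reals\<^esub> a \<in> dilations" if "a \<in> dilations" for a
        using dilations_inverse[OF that] dilations_nonzero[OF that]
        by (simp add: nonzero_reals_inv inverse_eq_divide)
    qed (simp add: dilations_mult)
    show "{1, -1} \<subseteq> dilations" using one_in_dilations minus_one_in_dilations by simp
    show "lam \<in> dilations" by (rule lam_in_dilations)
    show "g \<otimes>\<^bsub>nonzero_reals\<^esub> m \<otimes>\<^bsub>nonzero_reals\<^esub> inv\<^bsub>nonzero_reals\<^esub> g \<in> {1, - 1}"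
      if "g \<in> dilations" "m \<in> {1, - 1}" for g m
      using that dilations_nonzero[OF that(1)] by (auto simp: nonzero_reals_inv)
    show "\<exists>k::int. \<exists>m\<in>{1, -1}. g = lam [^]\<^bsub>nonzero_reals\<^esub> k \<otimes>\<^bsub>nonzero_reals\<^esub> m"
      if "g \<in> dilations" for g
      using that lam(2) unfolding dilations_def by (auto simp: nonzero_reals_int_pow)
  qed
qed

lemma polycyclic_integers: "polycyclic_in integer_group UNIV"
proof (rule polycyclic_in.cyclic_extension[OF polycyclic_in.trivial])
  have pow: "1 [^]\<^bsub>integer_group\<^esub> k = k" for k :: int
  proof -
    have "1 [^]\<^bsub>integer_group\<^esub> n = int n" for n :: nat
      by (induction n) (simp_all add: nat_pow_def)
    then show ?thesis by (simp add: int_pow_def2 inv_integer_group)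
  qed
  show "\<exists>k::int. \<exists>m\<in>{\<one>\<^bsub>integer_group\<^esub>}. g = 1 [^]\<^bsub>integer_group\<^esub> k \<otimes>\<^bsub>integer_group\<^esub> m" for g
    by (simp add: pow)
  show "subgroup UNIV integer_group" using group.subgroup_self[OF group_integer_group] by simp
qed (auto simp: inv_integer_group)

section \<open>An affine group of the integer lattice\<close>

text \<open>a and b are linear reflections whose composition b a is hyperbolic, of trace 3 and
  determinant 1. c is the half-turn about (1/2, 0), a point fixed by b, so b and c commute, and d =
  b c. The origin is the only fixed point of b a, and c moves it.\<close>

fun base_marking :: "letter \<Rightarrow> int \<times> int \<Rightarrow> int \<times> int" where
  "base_marking La (p, q) = (q, p)"
| "base_marking Lb (p, q) = (p + 3 * q, - q)"
| "base_marking Lc (p, q) = (1 - p, - q)"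
| "base_marking Ld (p, q) = (1 - p - 3 * q, q)"

definition base_group :: "(int \<times> int \<Rightarrow> int \<times> int) monoid" where
  "base_group = bijections\<lparr>carrier := range (eval_word bijections base_marking)\<rparr>"

text \<open>The two eigenfunctionals of the composition of b and a; they are exchanged by a.\<close>

definition eig :: "int \<times> int \<Rightarrow> real" where "eig = (\<lambda>(p, q). real_of_int p * lam + real_of_int q)"
definition eig' :: "int \<times> int \<Rightarrow> real" where "eig' = (\<lambda>(p, q). real_of_int p + real_of_int q * lam)"

lemma eig_add: "eig (x + y) = eig x + eig y" "eig' (x + y) = eig' x + eig' y"
  by (cases x; cases y; simp add: eig_def eig'_def algebra_simps)+

text \<open>The forms are linearly independent because \<open>lam ^ 2\<close> differs from 1.
  Lattice maps can thus be identified by their effect on both forms.\<close>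

lemma eig_inj:
  assumes "eig x = eig y" "eig' x = eig' y"
  shows "x = y"
proof -
  obtain p q r s where xy: "x = (p, q)" "y = (r, s)" by (cases x, cases y) blast
  define d d' where "d = real_of_int (p - r)" and "d' = real_of_int (q - s)"
  have e: "d * lam + d' = 0" "d + d' * lam = 0"
    using assms unfolding xy eig_def eig'_def d_def d'_def by (simp_all add: algebra_simps)
  have "d' = - (d * lam)" using e(1) by linarith
  then have "d * (lam ^ 2 - 1) = 0" using e(2) by (simp add: algebra_simps power2_eq_square)
  moreover have "lam ^ 2 - 1 \<noteq> 0" using lam by simp
  ultimately have "d = 0" by simp
  then show ?thesis using \<open>d' = - (d * lam)\<close> unfolding xy d_def d'_def by simp
qed

text \<open>The flag tells whether the linear part exchanges the two eigenforms. Their ratios are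
  tied as \<alpha> and 1 / \<alpha>, so if the flag is \<open>False\<close> and \<alpha> = 1, the
  map is a translation.\<close>

definition affine :: "bool \<Rightarrow> (int \<times> int \<Rightarrow> int \<times> int) \<Rightarrow> bool" where
  "affine \<sigma> g \<longleftrightarrow> (\<exists>\<alpha>\<in>dilations. \<exists>\<beta> \<beta>'. \<forall>x.
     eig (g x) = \<alpha> * (if \<sigma> then eig' x else eig x) + \<beta> \<and>
     eig' (g x) = 1 / \<alpha> * (if \<sigma> then eig x else eig' x) + \<beta>')"

lemma affineI:
  assumes "\<alpha> \<in> dilations"
    "\<And>x. eig (g x) = \<alpha> * (if \<sigma> then eig' x else eig x) + \<beta>"
    "\<And>x. eig' (g x) = 1 / \<alpha> * (if \<sigma> then eig x else eig' x) + \<beta>'"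
  shows "affine \<sigma> g"
  using assms unfolding affine_def by blast

lemma affine_comp:
  assumes "affine \<sigma> g" "affine \<tau> h"
  shows "affine (\<sigma> \<noteq> \<tau>) (g \<circ> h)"
proof -
  obtain \<alpha> \<beta> \<beta>' where g: "\<alpha> \<in> dilations" "\<And>x. eig (g x) = \<alpha> * (if \<sigma> then eig' x else eig x) + \<beta>"
    "\<And>x. eig' (g x) = 1 / \<alpha> * (if \<sigma> then eig x else eig' x) + \<beta>'"
    using assms(1) unfolding affine_def by blast
  obtain \<gamma> \<delta> \<delta>' where h: "\<gamma> \<in> dilations" "\<And>x. eig (h x) = \<gamma> * (if \<tau> then eig' x else eig x) + \<delta>"
    "\<And>x. eig' (h x) = 1 / \<gamma> * (if \<tau> then eig x else eig' x) + \<delta>'"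
    using assms(2) unfolding affine_def by blast
  show ?thesis
  proof (cases \<sigma>)
    \<comment> \<open>Here g exchanges the forms and so meets \<open>h\<close> through the other
      one: the ratio of h enters as 1 / \<gamma>, and the constants \<delta> and \<delta>' trade
      places.\<close>
    case True
    then show ?thesis
      using dilations_mult[OF g(1) dilations_inverse[OF h(1)]] g h
      by (intro affineI[of "\<alpha> * (1 / \<gamma>)" _ _ "\<alpha> * \<delta>' + \<beta>" "1 / \<alpha> * \<delta> + \<beta>'"]) (auto simp: distrib_left add_divide_distrib)
  next
    case False
    then show ?thesis
      using dilations_mult[OF g(1) h(1)] g h
      by (intro affineI[of "\<alpha> * \<gamma>" _ _ "\<alpha> * \<delta> + \<beta>" "1 / \<alpha> * \<delta>' + \<beta>'"]) (auto simp: distrib_left add_divide_distrib)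
  qed
qed

lemma affine_id: "affine False id"
  by (rule affineI[OF one_in_dilations, where \<beta> = 0 and \<beta>' = 0]) simp_all

lemma affine_inverse:
  assumes "affine False g" "g \<circ> h = id"
  shows "affine False h"
proof -
  obtain \<alpha> \<beta> \<beta>' where g: "\<alpha> \<in> dilations" "\<And>x. eig (g x) = \<alpha> * eig x + \<beta>" "\<And>x. eig' (g x) = 1 / \<alpha> * eig' x + \<beta>'"
    using assms(1) unfolding affine_def by auto
  have "g (h x) = x" for x using assms(2) by (metis comp_apply id_apply)
  then have gh: "eig x = \<alpha> * eig (h x) + \<beta>" "eig' x = 1 / \<alpha> * eig' (h x) + \<beta>'" for x
    using g(2,3)[of "h x"] by simp_all
  show ?thesis
  proof (rule affineI[OF dilations_inverse[OF g(1)]])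
    show "eig (h x) = 1 / \<alpha> * (if False then eig' x else eig x) + (- \<beta> / \<alpha>)" for x
      using gh(1)[of x] dilations_nonzero[OF g(1)] by (simp add: field_simps)
    show "eig' (h x) = 1 / (1 / \<alpha>) * (if False then eig x else eig' x) + (- \<alpha> * \<beta>')" for x
      using gh(2)[of x] dilations_nonzero[OF g(1)] by (simp add: field_simps)
  qed
qed

lemma affine_marking: "\<exists>\<sigma>. affine \<sigma> (base_marking x)"
proof (cases x)
  case La
  have "affine True (base_marking La)"
    by (rule affineI[OF one_in_dilations, where \<beta> = 0 and \<beta>' = 0]) (auto simp: eig_def eig'_def)
  then show ?thesis using La by blast
next
  case Lb
  have "affine True (base_marking Lb)"
  proof (rule affineI[OF lam_in_dilations, where \<beta> = 0 and \<beta>' = 0])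
    fix x :: "int \<times> int"
    obtain p q where x: "x = (p, q)" by (cases x)
    show "eig (base_marking Lb x) = lam * (if True then eig' x else eig x) + 0"
      "eig' (base_marking Lb x) = 1 / lam * (if True then eig x else eig' x) + 0"
      using lam_mult[of "real_of_int q" "real_of_int p"]
      unfolding x by (simp_all add: eig_def eig'_def add.commute)
  qed
  then show ?thesis using Lb by blast
next
  case Lc
  \<comment> \<open>The linear part is -1; \<open>lam\<close> and 1 are the values of the two forms
    at the translation vector (1, 0).\<close>
  have "affine False (base_marking Lc)"
    by (rule affineI[OF minus_one_in_dilations, where \<beta> = lam and \<beta>' = 1])
      (auto simp: eig_def eig'_def algebra_simps)
  then show ?thesis using Lc by blast
next
  case Ld
  have "affine True (base_marking Ld)"
  proof (rule affineI[where \<alpha> = "- lam" and \<beta> = lam and \<beta>' = 1])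
    show "- lam \<in> dilations" using dilationsI(2)[of 1] by simp
    fix x :: "int \<times> int"
    obtain p q where x: "x = (p, q)" by (cases x)
    have "eig (base_marking Ld x) = - (lam * (real_of_int q * lam + real_of_int p)) + lam"
      "eig' (base_marking Ld x) = - (1 / lam * (real_of_int q + real_of_int p * lam)) + 1"
      unfolding x lam_mult by (simp_all add: eig_def eig'_def algebra_simps)
    then show "eig (base_marking Ld x) = - lam * (if True then eig' x else eig x) + lam"
      "eig' (base_marking Ld x) = 1 / - lam * (if True then eig x else eig' x) + 1"
      unfolding x by (simp_all add: eig_def eig'_def add.commute)
  qed
  then show ?thesis using Ld by blast
qed

lemma marking_bijections: "klein_marking bijections base_marking"
proof (rule klein_markingI)
  have inv: "base_marking x \<circ> base_marking x = id" for x
    by (cases x) (auto simp: fun_eq_iff)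
  then show "base_marking x \<in> carrier bijections" for x
    by (auto intro: o_bij)
  show "base_marking x \<otimes>\<^bsub>bijections\<^esub> base_marking x = \<one>\<^bsub>bijections\<^esub>" for x
    using inv by simp
qed (auto simp: fun_eq_iff)

lemma base_group_simps [simp]:
  "f \<otimes>\<^bsub>base_group\<^esub> g = f \<circ> g" "\<one>\<^bsub>base_group\<^esub> = id"
  by (simp_all add: base_group_def)

lemma carrier_base_group: "carrier base_group = range (eval_word base_group base_marking)"
  by (simp add: base_group_def eval_word_def)

interpretation base: group base_group
proof -
  have "subgroup (range (eval_word bijections base_marking)) bijections"
    using klein_markingD[OF marking_bijections]
    by (intro group.eval_word_subgroup[OF group_bijections]) auto
  then show "group base_group"
    unfolding base_group_def by (rule group.subgroup_imp_group[OF group_bijections])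
qed

lemma marking_base_group: "klein_marking base_group base_marking"
proof -
  have "base_marking x \<in> carrier base_group" for x
    unfolding carrier_base_group by (rule range_eqI[of _ _ "[x]"]) simp
  then show ?thesis using marking_bijections unfolding klein_marking_def by auto
qed

lemma affine_base_group: "g \<in> carrier base_group \<Longrightarrow> \<exists>\<sigma>. affine \<sigma> g"
proof -
  have "\<exists>\<sigma>. affine \<sigma> (eval_word base_group base_marking w)" for w
  proof (induction w)
    case Nil
    show ?case using affine_id unfolding eval_word_simps base_group_simps by blast
  next
    case (Cons x w)
    then obtain \<sigma> \<tau> where "affine \<sigma> (base_marking x)" "affine \<tau> (eval_word base_group base_marking w)"
      using affine_marking by blast
    then show ?case unfolding eval_word_simps base_group_simps using affine_comp by blast
  qed
  then show "g \<in> carrier base_group \<Longrightarrow> \<exists>\<sigma>. affine \<sigma> g" unfolding carrier_base_group by blast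
qed

definition affine_part :: "(int \<times> int \<Rightarrow> int \<times> int) set" where
  "affine_part = {g \<in> carrier base_group. affine False g}"

lemma subgroup_affine_part: "subgroup affine_part base_group"
proof (rule base.subgroupI)
  have "\<one>\<^bsub>base_group\<^esub> \<in> affine_part" unfolding affine_part_def using base.one_closed affine_id by simp
  then show "affine_part \<noteq> {}" by blast
  show "inv\<^bsub>base_group\<^esub> g \<in> affine_part" if "g \<in> affine_part" for g
    using that base.r_inv[of g] affine_inverse[of g "inv\<^bsub>base_group\<^esub> g"] unfolding affine_part_def by simp
  show "g \<otimes>\<^bsub>base_group\<^esub> h \<in> affine_part" if "g \<in> affine_part" "h \<in> affine_part" for g h
    using that base.m_closed[of g h] affine_comp[of False g False h] unfolding affine_part_def by simp
qed (auto simp: affine_part_def)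

text \<open>Outside of \<open>affine_part\<close> both maps exchange the eigenforms, so their
  product preserves each of them up to ratio and shift.\<close>

lemma affine_part_index_two:
  assumes "g \<in> carrier base_group - affine_part" "h \<in> carrier base_group - affine_part"
  shows "g \<otimes>\<^bsub>base_group\<^esub> h \<in> affine_part"
proof -
  have "affine True k" if k: "k \<in> carrier base_group - affine_part" for k
  proof -
    obtain \<sigma> where "affine \<sigma> k" using affine_base_group k by blast
    then show ?thesis using k unfolding affine_part_def by (cases \<sigma>) auto
  qed
  then have "affine True g" "affine True h" using assms by blast+
  then show ?thesis using assms base.m_closed[of g h] affine_comp[of True g True h] unfolding affine_part_def by simp
qed

text \<open>\<open>eig\<close> is 0 at the origin and 1 at (0, 1), so on \<open>affine_part\<close>
  the values at these points determine \<alpha>; the value at the origin alone is \<beta>.\<close>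

definition ratio :: "(int \<times> int \<Rightarrow> int \<times> int) \<Rightarrow> real" where
  "ratio g = eig (g (0, 1)) - eig (g (0, 0))"
definition shift :: "(int \<times> int \<Rightarrow> int \<times> int) \<Rightarrow> real" where
  "shift g = eig (g (0, 0))"

lemma affine_part_apply:
  assumes "g \<in> affine_part"
  shows "ratio g \<in> dilations" "eig (g x) = ratio g * eig x + shift g"
    "eig' (g x) = 1 / ratio g * eig' x + eig' (g (0, 0))"
proof -
  obtain \<alpha> \<beta> \<beta>' where g: "\<alpha> \<in> dilations" "\<And>x. eig (g x) = \<alpha> * eig x + \<beta>" "\<And>x. eig' (g x) = 1 / \<alpha> * eig' x + \<beta>'"
    using assms unfolding affine_part_def affine_def by auto
  have "eig (0, 0) = 0" "eig (0, 1) = 1" "eig' (0, 0) = 0" by (simp_all add: eig_def eig'_def)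
  then have r: "ratio g = \<alpha>" "shift g = \<beta>" "eig' (g (0, 0)) = \<beta>'" using g unfolding ratio_def shift_def by auto
  show "ratio g \<in> dilations" "eig (g x) = ratio g * eig x + shift g"
    "eig' (g x) = 1 / ratio g * eig' x + eig' (g (0, 0))"
    unfolding r using g by auto
qed

lemma shift_comp: "g \<in> affine_part \<Longrightarrow> shift (g \<circ> h) = ratio g * shift h + shift g"
  using affine_part_apply(2)[of g "h (0, 0)"] unfolding shift_def by simp

lemma ratio_comp: "g \<in> affine_part \<Longrightarrow> ratio (g \<circ> h) = ratio g * ratio h"
  using affine_part_apply(2)[of g "h (0, 0)"] affine_part_apply(2)[of g "h (0, 1)"]
  unfolding ratio_def[of "g \<circ> h"] ratio_def[of h] by (simp add: algebra_simps)

lemma ratio_hom: "ratio \<in> hom (base_group\<lparr>carrier := affine_part\<rparr>) nonzero_reals"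
  using affine_part_apply(1) dilations_nonzero by (auto simp: hom_def ratio_comp)

lemma translation_apply:
  assumes "g \<in> affine_part" "ratio g = 1"
  shows "g x = x + g (0, 0)"
proof (rule eig_inj)
  show "eig (g x) = eig (x + g (0, 0))" "eig' (g x) = eig' (x + g (0, 0))"
    using affine_part_apply(2,3)[OF assms(1), of x] assms(2) by (simp_all add: eig_add shift_def)
qed

text \<open>A translation is known from its value at the origin, whose two integer coordinates give
  the first two steps of the series: \<open>T'\<close> by the second coordinate, then
  \<open>T\<close> by the first. Then \<open>ratio\<close> leads from the translations to
  \<open>affine_part\<close>, and the last step has index at most two.\<close>

lemma polycyclic_base_group: "polycyclic_in base_group (carrier base_group)"
proof -
  define T where "T = {g \<in> affine_part. ratio g = \<one>\<^bsub>nonzero_reals\<^esub>}"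
  have T: "subgroup T base_group"
  proof -
    interpret N: group "base_group\<lparr>carrier := affine_part\<rparr>"
      using base.subgroup_imp_group[OF subgroup_affine_part] .
    interpret ratio: group_hom "base_group\<lparr>carrier := affine_part\<rparr>" nonzero_reals ratio
      using ratio_hom by unfold_locales
    have "subgroup T (base_group\<lparr>carrier := affine_part\<rparr>)"
      using ratio.subgroup_kernel unfolding kernel_def T_def by simp
    then show ?thesis using base.incl_subgroup[OF subgroup_affine_part] by blast
  qed
  have T_apply: "g x = x + g (0, 0)" if "g \<in> T" for g x
    using that translation_apply unfolding T_def by simp
  have fst_hom: "(\<lambda>g. fst (g (0, 0))) \<in> hom (base_group\<lparr>carrier := T\<rparr>) integer_group"
  proof (rule homI)
    show "fst ((g \<otimes>\<^bsub>base_group\<lparr>carrier := T\<rparr>\<^esub> h) (0, 0)) = fst (g (0, 0)) \<otimes>\<^bsub>integer_group\<^esub> fst (h (0, 0))"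
      if "g \<in> carrier (base_group\<lparr>carrier := T\<rparr>)" for g h
      using that T_apply[of g "h (0, 0)"] by simp
  qed simp
  define T' where "T' = {g \<in> T. fst (g (0, 0)) = \<one>\<^bsub>integer_group\<^esub>}"
  have T': "subgroup T' base_group"
  proof -
    interpret T: group "base_group\<lparr>carrier := T\<rparr>"
      using base.subgroup_imp_group[OF T] .
    interpret fst: group_hom "base_group\<lparr>carrier := T\<rparr>" integer_group "\<lambda>g. fst (g (0, 0))"
      using fst_hom group_integer_group by (simp add: group_hom_def group_hom_axioms_def T.group_axioms)
    have "subgroup T' (base_group\<lparr>carrier := T\<rparr>)"
      using fst.subgroup_kernel unfolding kernel_def T'_def by simp
    then show ?thesis using base.incl_subgroup[OF T] by blast
  qed
  have snd_hom: "(\<lambda>g. snd (g (0, 0))) \<in> hom (base_group\<lparr>carrier := T'\<rparr>) integer_group"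
  proof (rule homI)
    show "snd ((g \<otimes>\<^bsub>base_group\<lparr>carrier := T'\<rparr>\<^esub> h) (0, 0)) = snd (g (0, 0)) \<otimes>\<^bsub>integer_group\<^esub> snd (h (0, 0))"
      if "g \<in> carrier (base_group\<lparr>carrier := T'\<rparr>)" for g h
      using that T_apply[of g "h (0, 0)"] unfolding T'_def by simp
  qed simp
  have "{g \<in> T'. snd (g (0, 0)) = \<one>\<^bsub>integer_group\<^esub>} = {\<one>\<^bsub>base_group\<^esub>}"
  proof -
    have "g = id" if "g \<in> T'" "snd (g (0, 0)) = 0" for g
    proof
      have "g (0, 0) = 0" using that unfolding T'_def by (simp add: prod_eq_iff)
      then show "g x = id x" for x using T_apply[of g x] that unfolding T'_def by simp
    qed
    then show ?thesis using subgroup.one_closed[OF T'] by auto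
  qed
  then have "polycyclic_in base_group {g \<in> T'. snd (g (0, 0)) \<in> UNIV}"
    using polycyclic_in.trivial[of base_group]
    by (intro polycyclic_in_vimage[OF base.group_axioms T' group_integer_group snd_hom _ polycyclic_integers]) simp
  then have "polycyclic_in base_group {g \<in> T. fst (g (0, 0)) \<in> UNIV}"
    unfolding T'_def
    by (intro polycyclic_in_vimage[OF base.group_axioms T group_integer_group fst_hom _ polycyclic_integers]) simp
  then have "polycyclic_in base_group {g \<in> affine_part. ratio g \<in> dilations}"
    unfolding T_def
    by (intro polycyclic_in_vimage[OF base.group_axioms subgroup_affine_part nonzero_reals.group_axioms
          ratio_hom _ polycyclic_dilations]) simp
  moreover have "{g \<in> affine_part. ratio g \<in> dilations} = affine_part"
    using affine_part_apply(1) by blast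
  ultimately have N: "polycyclic_in base_group affine_part" by simp
  interpret N: subgroup affine_part base_group by (rule subgroup_affine_part)
  show ?thesis
  proof (cases "affine_part = carrier base_group")
    case False
    then obtain t where t: "t \<in> carrier base_group" "t \<notin> affine_part" using N.subset by blast
    have inv_out: "inv\<^bsub>base_group\<^esub> g \<notin> affine_part" if "g \<in> carrier base_group" "g \<notin> affine_part" for g
      using that N.m_inv_closed[of "inv\<^bsub>base_group\<^esub> g"] by auto
    show ?thesis
    proof (rule polycyclic_in.cyclic_extension[OF N base.subgroup_self N.subset])
      show "t \<in> carrier base_group" by fact
      show "g \<otimes>\<^bsub>base_group\<^esub> m \<otimes>\<^bsub>base_group\<^esub> inv\<^bsub>base_group\<^esub> g \<in> affine_part"
        if g: "g \<in> carrier base_group" and m: "m \<in> affine_part" for g m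
      proof (cases "g \<in> affine_part")
        case False
        have "g \<otimes>\<^bsub>base_group\<^esub> m \<notin> affine_part"
        proof
          assume "g \<otimes>\<^bsub>base_group\<^esub> m \<in> affine_part"
          then have "g \<otimes>\<^bsub>base_group\<^esub> m \<otimes>\<^bsub>base_group\<^esub> inv\<^bsub>base_group\<^esub> m \<in> affine_part"
            using m by blast
          then show False using g m False by (simp add: base.m_assoc del: base_group_simps)
        qed
        then show ?thesis
          using g m inv_out[OF g False] by (intro affine_part_index_two) (auto simp del: base_group_simps)
      qed (use m in \<open>auto simp del: base_group_simps\<close>)
      show "\<exists>k::int. \<exists>m\<in>affine_part. g = t [^]\<^bsub>base_group\<^esub> k \<otimes>\<^bsub>base_group\<^esub> m"
        if g: "g \<in> carrier base_group" for g
      proof (cases "g \<in> affine_part")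
        case True
        then show ?thesis by (intro exI[of _ 0] bexI[of _ g]) simp_all
      next
        case False
        have "inv\<^bsub>base_group\<^esub> t \<otimes>\<^bsub>base_group\<^esub> g \<in> affine_part"
          using g t False inv_out[OF t] by (intro affine_part_index_two) auto
        moreover have "g = t [^]\<^bsub>base_group\<^esub> (1 :: int) \<otimes>\<^bsub>base_group\<^esub> (inv\<^bsub>base_group\<^esub> t \<otimes>\<^bsub>base_group\<^esub> g)"
          using g t by (simp del: base_group_simps flip: base.m_assoc)
        ultimately show ?thesis by blast
      qed
    qed
  qed (use N in simp)
qed

text \<open>\<open>ratio\<close> is multiplicative with values in a commutative group, so
  commutators in \<open>affine_part\<close> have ratio 1. They are translations, and translations
  commute.\<close>

lemma virtually_metabelian_base_group: "\<exists>M col. virtually_metabelian_map base_group M col"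
proof -
  interpret N: subgroup affine_part base_group by (rule subgroup_affine_part)
  define col where "col g = (if g \<in> affine_part then 0 else 1 :: nat)" for g
  have "virtually_metabelian_map base_group affine_part col"
    unfolding virtually_metabelian_map_def
  proof (intro conjI ballI impI)
    show "subgroup affine_part base_group" by (rule subgroup_affine_part)
    have "col ` carrier base_group \<subseteq> {0, 1}" unfolding col_def by auto
    then show "finite (col ` carrier base_group)" by (rule finite_subset) simp
    show "g \<otimes>\<^bsub>base_group\<^esub> inv\<^bsub>base_group\<^esub> h \<in> affine_part"
      if "g \<in> carrier base_group" "h \<in> carrier base_group" "col g = col h" for g h
    proof (cases "h \<in> affine_part")
      case True
      then have "g \<in> affine_part" using that(3) unfolding col_def by (simp split: if_splits)
      then show ?thesis using True by blast
    next
      case False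
      then have "g \<notin> affine_part" using that(3) unfolding col_def by (simp split: if_splits)
      moreover have "inv\<^bsub>base_group\<^esub> h \<notin> affine_part"
        using that False N.m_inv_closed[of "inv\<^bsub>base_group\<^esub> h"] by auto
      ultimately show ?thesis using that by (intro affine_part_index_two) auto
    qed
    have der: "g \<in> affine_part \<and> ratio g = 1" if g_der: "g \<in> derived_set base_group affine_part" for g
    proof -
      obtain x y where x: "x \<in> affine_part" and y: "y \<in> affine_part"
        and g: "g = x \<otimes>\<^bsub>base_group\<^esub> y \<otimes>\<^bsub>base_group\<^esub> inv\<^bsub>base_group\<^esub> x \<otimes>\<^bsub>base_group\<^esub> inv\<^bsub>base_group\<^esub> y"
        using g_der by blast
      have r: "ratio (inv\<^bsub>base_group\<^esub> z) * ratio z = 1" if "z \<in> affine_part" for z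
      proof -
        have "ratio (inv\<^bsub>base_group\<^esub> z \<otimes>\<^bsub>base_group\<^esub> z) = ratio (inv\<^bsub>base_group\<^esub> z) * ratio z"
          using ratio_comp[of "inv\<^bsub>base_group\<^esub> z" z] that by simp
        then show ?thesis using base.l_inv[of z] N.mem_carrier[OF that]
          by (simp add: ratio_def eig_def del: base_group_simps(1))
      qed
      have "g \<in> affine_part" unfolding g by (intro N.m_closed N.m_inv_closed x y)
      moreover have "ratio g = ratio x * ratio y * ratio (inv\<^bsub>base_group\<^esub> x) * ratio (inv\<^bsub>base_group\<^esub> y)"
        using x y N.m_closed[OF x y] N.m_closed[OF N.m_closed[OF x y] N.m_inv_closed[OF x]]
        unfolding g by (simp add: ratio_comp)
      then have "ratio g = (ratio (inv\<^bsub>base_group\<^esub> x) * ratio x) * (ratio (inv\<^bsub>base_group\<^esub> y) * ratio y)"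
        by (simp only: mult_ac)
      then have "ratio g = 1" using r[OF x] r[OF y] by simp
      ultimately show ?thesis by blast
    qed
    show "g \<otimes>\<^bsub>base_group\<^esub> h = h \<otimes>\<^bsub>base_group\<^esub> g"
      if gh: "g \<in> derived_set base_group affine_part" "h \<in> derived_set base_group affine_part" for g h
    proof -
      note g = der[OF gh(1)] and h = der[OF gh(2)]
      have "g (h x) = h (g x)" for x
        using translation_apply[of g x] translation_apply[of g "h x"]
          translation_apply[of h x] translation_apply[of h "g x"] g h by (simp add: add_ac)
      then show ?thesis by (simp add: fun_eq_iff)
    qed
  qed
  then show ?thesis by blast
qed

lemma uniform_growth_base_group: "\<exists>c>1. uniform_growth base_group c"
proof (rule exponential_uniform_growth_index_two[OF base.group_axioms subgroup_affine_part affine_part_index_two])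
  let ?N = "base_group\<lparr>carrier := affine_part\<rparr>"
  show N: "group ?N" using base.subgroup_imp_group[OF subgroup_affine_part] .
  \<comment> \<open>The identity serves as the surjection: ping-pong takes place in
    \<open>affine_part\<close>, and the index-two lemma carries its growth to the whole
    group.\<close>
  show "(\<lambda>g. g) \<in> hom ?N ?N" "(\<lambda>g. g) ` affine_part = carrier ?N" by (auto simp: hom_def)
  interpret N: group "?N" by (rule N)
  have e: "base_marking x \<in> carrier base_group" for x using klein_markingD(1)[OF marking_base_group] .
  define s where "s = base_marking Lb \<circ> base_marking La"
  define t where "t = base_marking Lc"
  have s: "s \<in> affine_part"
  proof -
    have "eig (s x) = lam * eig x \<and> eig' (s x) = 1 / lam * eig' x" for x
      using lam_mult[of "real_of_int (fst x)" "real_of_int (snd x)"]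
      by (cases x) (simp add: s_def eig_def eig'_def algebra_simps)

    then have "affine False s" by (intro affineI[OF lam_in_dilations, where \<beta> = 0 and \<beta>' = 0]) auto
    moreover have "s \<in> carrier base_group" using base.m_closed[OF e e, of Lb La] unfolding s_def by simp
    ultimately show ?thesis unfolding affine_part_def by simp
  qed
  have t: "t \<in> affine_part"
  proof -
    have "affine False t"
      unfolding t_def
      by (rule affineI[OF minus_one_in_dilations, where \<beta> = lam and \<beta>' = 1])
        (auto simp: eig_def eig'_def algebra_simps)
    then show ?thesis using e unfolding affine_part_def t_def by simp
  qed
  have st: "ratio s = lam" "shift s = 0" "ratio t = -1" "shift t = lam"
    unfolding ratio_def shift_def s_def t_def by (simp_all add: eig_def)
  have "uniform_growth ?N (root 3 2)"
  proof (rule N.uniform_growth_affine[where \<alpha> = ratio and \<beta> = shift])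
    show "ratio g \<noteq> 0 \<and> (\<bar>ratio g\<bar> = 1 \<or> \<bar>ratio g\<bar> \<le> 1 / 2 \<or> \<bar>ratio g\<bar> \<ge> 2)" if "g \<in> carrier ?N" for g
      using that affine_part_apply(1)[of g] dilations_nonzero dilations_bounds by auto
    show "\<exists>g\<in>carrier ?N. \<bar>ratio g\<bar> \<noteq> 1" using s st lam(2) by force
    \<comment> \<open>The two values are \<open>lam ^ 2\<close> and \<open>lam\<close>: s fixes the
      origin, while t moves it to (1, 0).\<close>
    have "shift (s \<otimes>\<^bsub>?N\<^esub> t) \<noteq> shift (t \<otimes>\<^bsub>?N\<^esub> s)"
      using s t st lam by (simp add: shift_comp power2_eq_square)
    then show "\<exists>g\<in>carrier ?N. \<exists>h\<in>carrier ?N. shift (g \<otimes>\<^bsub>?N\<^esub> h) \<noteq> shift (h \<otimes>\<^bsub>?N\<^esub> g)"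
      using s t by auto
  qed (simp_all add: ratio_comp shift_comp)
  moreover have "root 3 2 > (1 :: real)" by simp
  ultimately show "\<exists>c>1. uniform_growth ?N c" by blast
qed

section \<open>Iteration and the entropy bounds\<close>

lemma slow_group_base: "slow_group base_group base_marking (ln 5)"
proof -
  have "real (card (weight_ball base_group base_marking n)) \<le> 1 * exp (ln 5 * real n)" for n
  proof -
    have "real (card (weight_ball base_group base_marking n)) \<le> real (5 ^ n)"
      using card_weight_ball_le by (simp only: of_nat_le_iff)
    also have "real (5 ^ n) = exp (ln 5 * real n)"
      by (simp add: exp_of_nat2_mult)
    finally show ?thesis by simp
  qed
  then show ?thesis
    unfolding slow_group_def
    using base.group_axioms marking_base_group carrier_base_group polycyclic_base_group
      virtually_metabelian_base_group uniform_growth_base_group zero_less_one by blast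
qed

lemma slow_group_exists: "\<exists>(G :: nat monoid) e. slow_group G e ((7 / 8) ^ k * ln 5)"
proof (induction k)
  case 0
  then show ?case using slow_group_nat[OF slow_group_base] by simp
next
  case (Suc k)
  then obtain G :: "nat monoid" and e where G: "slow_group G e ((7 / 8) ^ k * ln 5)" by blast
  have "\<exists>(G' :: nat monoid) e'. slow_group G' e' (7 / 8 * ((7 / 8) ^ k * ln 5))"
    by (rule slow_group_nat[OF slow_group_recursion[OF G]]) simp
  then show ?case by (simp only: power_Suc mult.assoc)
qed

text \<open>Three elements suffice because d = b c. The whole marking is symmetric, its elements
  being involutions, and is the set on which the entropy is estimated from above.\<close>

lemma slow_group_generators:
  assumes "slow_group G e \<mu>"
  shows "symmetric_generating_set G (range e)" "generate G {e La, e Lb, e Lc} = carrier G"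
proof -
  interpret group G using assms unfolding slow_group_def by blast
  have e: "klein_marking G e" and carr: "carrier G = range (eval_word G e)"
    using assms unfolding slow_group_def by blast+
  note e = klein_markingD[OF e]
  have sub: "{e La, e Lb, e Lc} \<subseteq> carrier G" using e(1) by blast
  define A where "A = {e La, e Lb, e Lc}"
  have "e La \<in> generate G A" and bc: "e Lb \<in> generate G A" "e Lc \<in> generate G A"
    by (rule generate.incl; simp add: A_def)+
  moreover have "e Ld \<in> generate G A" using generate.eng[OF bc] e(3)[of Lb Lc Ld] by simp
  ultimately have "e x \<in> generate G A" for x by (cases x) simp_all
  then have "eval_word G e w \<in> generate G A" for w
    by (induction w) (auto intro: generate.one generate.eng)
  then have "carrier G \<subseteq> generate G A" unfolding carr by (rule image_subsetI)
  then show gen: "generate G {e La, e Lb, e Lc} = carrier G"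
    using generate_incl[OF sub] unfolding A_def by (rule equalityI[rotated])
  have range: "range e \<subseteq> carrier G" using e(1) by (rule image_subsetI)
  have "generate G (range e) = carrier G"
  proof
    show "generate G (range e) \<subseteq> carrier G" using range by (rule generate_incl)
    have "{e La, e Lb, e Lc} \<subseteq> range e" by simp
    then show "carrier G \<subseteq> generate G (range e)" using mono_generate gen by metis
  qed
  moreover have "inv\<^bsub>G\<^esub> (e x) = e x" for x using e(1,2) by (intro inv_equality) auto
  ultimately show "symmetric_generating_set G (range e)"
    unfolding symmetric_generating_set_def using range by simp
qed

text \<open>Uniform growth bounds the infimum from below by \<open>ln c\<close>, and the marking
  bounds it from above. Letters weigh at most 3, so an n-ball lies in the weighted ball of radius 3
  n, whence the factor 3.\<close>

lemma slow_group_entropy: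
  assumes slow: "slow_group G e \<mu>"
  shows "0 < algebraic_entropy G" "algebraic_entropy G \<le> 3 * \<mu>"
proof -
  interpret group G using assms unfolding slow_group_def by blast
  note gen = slow_group_generators(1)[OF slow]
  obtain c where c: "c > 1" "uniform_growth G c" using slow unfolding slow_group_def by blast
  obtain K where K: "K > 0" "\<And>n. real (card (weight_ball G e n)) \<le> K * exp (\<mu> * real n)"
    using slow unfolding slow_group_def by blast
  have S: "range e \<subseteq> carrier G" "finite (range e)"
    using gen unfolding symmetric_generating_set_def by simp_all
  have lower: "ln c \<le> growth_entropy G S" if S: "finite S" "symmetric_generating_set G S" for S
  proof -
    obtain K where "K > 0" "\<And>n. K * c ^ n \<le> real (card (word_ball G S n))"
      using c(2) S unfolding uniform_growth_def by blast
    then show ?thesis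
      using S c(1) unfolding symmetric_generating_set_def by (intro growth_entropy_ge[of S K c]) auto
  qed
  have "ln c \<le> algebraic_entropy G"
    unfolding algebraic_entropy_def
    using lower gen S(2) by (intro cINF_greatest) blast+
  then show "0 < algebraic_entropy G" using c(1) ln_gt_zero[of c] by linarith
  have "word_ball G (range e) n \<subseteq> weight_ball G e (3 * n)" for n
  proof
    fix g assume "g \<in> word_ball G (range e) n"
    then obtain v where v: "set v \<subseteq> range e" "length v \<le> n" "g = foldr (\<otimes>\<^bsub>G\<^esub>) v \<one>\<^bsub>G\<^esub>"
      unfolding word_ball_def by blast
    then obtain w where "v = map e w" by (metis ex_map_conv image_iff subsetD)
    then show "g \<in> weight_ball G e (3 * n)"
      using v word_weight_le_length[of w] unfolding weight_ball_def by (auto simp: eval_word_foldr)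
  qed
  then have "real (card (word_ball G (range e) n)) \<le> K * exp (3 * \<mu> * real n)" for n
    using card_mono[OF finite_weight_ball, of "word_ball G (range e) n" G e "3 * n"] K(2)[of "3 * n"]
    by (simp add: mult_ac)
  then have "growth_entropy G (range e) \<le> 3 * \<mu>" by (rule growth_entropy_le[OF S K(1)])
  moreover have "algebraic_entropy G \<le> growth_entropy G (range e)"
    unfolding algebraic_entropy_def
    using lower gen S(2) by (intro cINF_lower bdd_belowI2[where m = "ln c"]) auto
  ultimately show "algebraic_entropy G \<le> 3 * \<mu>" by linarith
qed

theorem proposition3:
  fixes \<epsilon> :: real
  assumes "\<epsilon> > 0"
  shows "\<exists>G :: nat monoid. group G \<and> polycyclic G \<and> virtually_metabelian G \<and>
           (\<exists>a\<in>carrier G. \<exists>b\<in>carrier G. \<exists>c\<in>carrier G. generate G {a, b, c} = carrier G) \<and>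
           0 < algebraic_entropy G \<and> algebraic_entropy G < \<epsilon>"
proof -
  obtain k :: nat where "(7 / 8) ^ k < \<epsilon> / (3 * ln 5)"
    using real_arch_pow_inv[of "\<epsilon> / (3 * ln 5)" "7 / 8"] assms by auto
  then have k: "3 * ((7 / 8) ^ k * ln 5) < \<epsilon>" by (simp add: field_simps)
  obtain G :: "nat monoid" and e where slow: "slow_group G e ((7 / 8) ^ k * ln 5)"
    using slow_group_exists by blast
  interpret group G using slow unfolding slow_group_def by blast
  have "polycyclic G" using slow polycyclic_in_imp_polycyclic unfolding slow_group_def by blast
  moreover have "virtually_metabelian G"
    using slow virtually_metabelian_mapD[OF group_axioms] unfolding slow_group_def by blast
  moreover have "e x \<in> carrier G" for x
    using slow klein_markingD(1) unfolding slow_group_def by blast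
  then have "\<exists>a\<in>carrier G. \<exists>b\<in>carrier G. \<exists>c\<in>carrier G. generate G {a, b, c} = carrier G"
    using slow_group_generators(2)[OF slow] by blast
  moreover have "0 < algebraic_entropy G" "algebraic_entropy G < \<epsilon>"
    using slow_group_entropy[OF slow] k by linarith+
  ultimately show ?thesis using group_axioms by blast
qed

end
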